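(* Let $G$ be a finite simple edge-twin-free graph with $m$ edges and no isolated edge. Then $\gamma'_L(G)\le \frac{m}{2}$.
   Context: An isolated edge of $G$ is an edge both of whose ends have degree $1$. For an edge $e$, $N(e)$ is the set of edges different from $e$ sharing an end with $e$, and $N[e]=N(e)\cup\{e\}$. Distinct edges $e,f$ are edge-twins if $N(e)=N(f)$ or $N[e]=N[f]$; $G$ is edge-twin-free if it has no pair of edge-twins. A set $D\subseteq E(G)$ is an edge-locating-dominating set if every edge in $E(G)\setminus D$ shares an end with some edge of $D$, and for every two distinct edges $e,f\in E(G)\setminus D$ we have $N(e)\cap D\neq N(f)\cap D$. The edge-location-domination number $\gamma'_L(G)$ is the minimum cardinality of an edge-locating-dominating set of $G$. *)

theory Defs
  imports Complex_Main
begin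

locale fin_simple_graph =
  fixes V :: "'a set" and E :: "'a set set"
  assumes finite_vertices: "finite V"
    and edge_subset: "e \<in> E \<Longrightarrow> e \<subseteq> V"
    and edge_card: "e \<in> E \<Longrightarrow> card e = 2"

definition degree :: "'a set set \<Rightarrow> 'a \<Rightarrow> nat" where
  "degree E v = card {e \<in> E. v \<in> e}"

definition isolated_edge :: "'a set set \<Rightarrow> 'a set \<Rightarrow> bool" where
  "isolated_edge E e \<longleftrightarrow> e \<in> E \<and> (\<forall>v\<in>e. degree E v = 1)"

definition edge_nbhd :: "'a set set \<Rightarrow> 'a set \<Rightarrow> 'a set set" where
  "edge_nbhd E e = {f \<in> E. f \<noteq> e \<and> f \<inter> e \<noteq> {}}"

definition closed_edge_nbhd :: "'a set set \<Rightarrow> 'a set \<Rightarrow> 'a set set" where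
  "closed_edge_nbhd E e = edge_nbhd E e \<union> {e}"

definition edge_twins :: "'a set set \<Rightarrow> 'a set \<Rightarrow> 'a set \<Rightarrow> bool" where
  "edge_twins E e f \<longleftrightarrow> e \<in> E \<and> f \<in> E \<and> e \<noteq> f \<and>
     (edge_nbhd E e = edge_nbhd E f \<or> closed_edge_nbhd E e = closed_edge_nbhd E f)"

definition edge_twin_free :: "'a set set \<Rightarrow> bool" where
  "edge_twin_free E \<longleftrightarrow> (\<nexists>e f. edge_twins E e f)"

definition edge_locating_dominating :: "'a set set \<Rightarrow> 'a set set \<Rightarrow> bool" where
  "edge_locating_dominating E D \<longleftrightarrow>
     D \<subseteq> E \<and>
     (\<forall>e \<in> E - D. \<exists>d \<in> D. e \<inter> d \<noteq> {}) \<and>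
     (\<forall>e \<in> E - D. \<forall>f \<in> E - D. e \<noteq> f \<longrightarrow> edge_nbhd E e \<inter> D \<noteq> edge_nbhd E f \<inter> D)"

text \<open>
  For a finite edge set the minimum below is taken over a finite nonempty set of
  cardinalities, since \<open>E\<close> itself is edge-locating-dominating.
\<close>

definition edge_location_domination_number :: "'a set set \<Rightarrow> nat" where
  "edge_location_domination_number E = Min (card ` {D. edge_locating_dominating E D})"

lemma edge_locating_dominating_self: "edge_locating_dominating E E"
  by (simp add: edge_locating_dominating_def)

lemma finite_edge_locating_dominating:
  "finite E \<Longrightarrow> finite {D. edge_locating_dominating E D}"
  by (rule finite_subset[of _ "Pow E"]) (auto simp: edge_locating_dominating_def)

lemma (in fin_simple_graph) finite_edges: "finite E"
  by (rule finite_subset[of _ "Pow V"]) (auto simp: finite_vertices dest: edge_subset)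

end

theory Submission imports Defs begin

text \<open>The edges are split into two classes, each of which is almost edge-locating-dominating; the
  smaller one has at most half of the edges. Two edges outside a set \<open>D\<close> have the same neighbours
  in \<open>D\<close> only near a component of \<open>D\<close> with at most four vertices. Pairs forming a one-edge component
  of \<open>D\<close> are the real obstruction: they must not lie in a triangle, nor face each other in a 4-cycle, nor
  have leaves outside \<open>D\<close> at both ends. Larger components can be repaired by rearranging
  their edges.

  The two classes are found by a depth-first search which visits a vertex together with its pendant
  edge. A new vertex is joined to the top of the stack and to some ancestors. Only the top
  may demand a colour, every other ancestor already meets both classes, so the edges to the ancestors
  are free. If the ancestors \<open>x\<close> and \<open>y\<close> are consecutive on the stack and \<open>{x, y}\<close> is a one-edge
  component, then the edge to \<open>x\<close> gets the colour of \<open>{x, y}\<close>, which destroys this component.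
  If there are no leaves, a half-edge is added at the root and removed in the end.\<close>

section \<open>Degrees and one-edge components\<close>

text \<open>Two facts make the search work. An edge that is not a tree edge leads to a vertex still
  on the stack, and a stack vertex below the top has both an entering and a leaving edge, so it
  already meets both colours. The root has no parent; a pendant edge stands in for its missing
  entering edge, which is why a root without one is given a half-edge. Secondly, the top never
  demands two colours at once. Opposite demands would enclose it in a 4-cycle forming a whole
  component of the visited part, yet the stack connects it to the pendant edge at the root. The
  repairs never increase a cardinality and are made in the two classes separately. The two final
  sets may overlap; the sum of their cardinalities is still at most the number of edges, and this is
  where the factor one half comes from.\<close>

definition lone :: "'a set set \<Rightarrow> 'a \<Rightarrow> 'a \<Rightarrow> bool" where
  "lone D x y \<longleftrightarrow> x \<noteq> y \<and> {x, y} \<in> D \<and> (\<forall>d\<in>D. x \<in> d \<or> y \<in> d \<longrightarrow> d = {x, y})"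

definition colour_class :: "'a set set \<Rightarrow> ('a set \<Rightarrow> bool) \<Rightarrow> bool \<Rightarrow> 'a set set" where
  "colour_class H c k = {e \<in> H. c e = k}"

lemma lone_sym: "lone D x y \<Longrightarrow> lone D y x"
  by (auto simp: lone_def insert_commute)

lemma lone_eq: "lone D x y \<Longrightarrow> d \<in> D \<Longrightarrow> x \<in> d \<or> y \<in> d \<Longrightarrow> d = {x, y}"
  by (auto simp: lone_def)

lemma in_colour_class [simp]: "e \<in> colour_class H c k \<longleftrightarrow> e \<in> H \<and> c e = k"
  by (simp add: colour_class_def)

lemma degree_ge2:
  assumes "finite H" "e \<in> H" "f \<in> H" "x \<in> e" "x \<in> f" "e \<noteq> f"
  shows "2 \<le> degree H x"
proof -
  have "card {e, f} \<le> card {e \<in> H. x \<in> e}"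
    using assms by (intro card_mono) auto
  then show ?thesis using assms(6) by (simp add: degree_def)
qed

lemma degree_2_cases:
  assumes "finite H" "degree H x = 2" "e \<in> H" "f \<in> H" "x \<in> e" "x \<in> f" "e \<noteq> f" "d \<in> H" "x \<in> d"
  shows "d = e \<or> d = f"
proof (rule ccontr)
  assume "\<not> ?thesis"
  then have "card {d, e, f} = 3" using assms by auto
  moreover have "card {d, e, f} \<le> card {e \<in> H. x \<in> e}"
    using assms by (intro card_mono) auto
  ultimately show False using assms(2) by (simp add: degree_def)
qed

lemma degree_pos: "finite H \<Longrightarrow> e \<in> H \<Longrightarrow> x \<in> e \<Longrightarrow> 1 \<le> degree H x"
  unfolding degree_def by (metis (mono_tags, lifting) One_nat_def Suc_leI card_gt_0_iff empty_iff finite_subset mem_Collect_eq subsetI)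

lemma degree_1_unique:
  assumes "degree H x = 1" "e \<in> H" "x \<in> e" "f \<in> H" "x \<in> f"
  shows "e = f"
proof -
  obtain d where d: "{e \<in> H. x \<in> e} = {d}"
    using assms(1) unfolding degree_def by (metis card_1_singletonE)
  have "e \<in> {e \<in> H. x \<in> e}" "f \<in> {e \<in> H. x \<in> e}" using assms by auto
  then show ?thesis unfolding d by simp
qed

section \<open>Colouring along a depth-first search\<close>

text \<open>Colourings of the part of a graph visited by a depth-first search with stack \<open>xs\<close> (root first).
  A singleton \<open>{x}\<close> stands for the pendant edge at \<open>x\<close>; pendant edges occur only in this form.
  The exceptions for degree 2 are exactly the configurations that force edge-twins, apart from two
  adjacent degree-2 vertices on a 4-cycle in \<open>square\<close>.\<close>
locale stack_colouring =
  fixes H :: "'a set set" and c :: "'a set \<Rightarrow> bool" and xs :: "'a list"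
  assumes fin: "finite H"
    and sizes: "e \<in> H \<Longrightarrow> card e = 1 \<or> card e = 2"
    and distinct_stack: "distinct xs"
    and root: "xs \<noteq> [] \<Longrightarrow> {xs ! 0} \<in> H"
    and path: "Suc i < length xs \<Longrightarrow> {xs ! i, xs ! Suc i} \<in> H"
    and consecutive: "lone (colour_class H c k) (xs ! i) (xs ! j) \<Longrightarrow> i < j \<Longrightarrow> j < length xs \<Longrightarrow> j = Suc i"
    and both_colours: "2 \<le> degree H v \<Longrightarrow> \<exists>e\<in>H. v \<in> e \<and> c e = k"
    and triangle: "lone (colour_class H c k) x y \<Longrightarrow> {x, z} \<in> H \<Longrightarrow> {y, z} \<in> H \<Longrightarrow> z \<notin> {x, y} \<Longrightarrow>
      degree H x = 2 \<and> degree H y = 2"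
    and square: "lone (colour_class H c k) x y \<Longrightarrow> lone (colour_class H c k) z w \<Longrightarrow>
      {x, y} \<inter> {z, w} = {} \<Longrightarrow> {x, z} \<in> H \<Longrightarrow> {y, w} \<in> H \<Longrightarrow>
      degree H x = 2 \<and> degree H y = 2 \<or> degree H z = 2 \<and> degree H w = 2"
    and half_edges: "lone (colour_class H c k) x y \<Longrightarrow> {x} \<in> H \<Longrightarrow> {y} \<in> H \<Longrightarrow>
      degree H x = 2 \<and> degree H y = 2"
    and cherry: "{x, y} \<in> colour_class H c k \<Longrightarrow> {y, z} \<in> colour_class H c k \<Longrightarrow>
      {x, z} \<in> H \<Longrightarrow> c {x, z} \<noteq> k \<Longrightarrow> x \<noteq> y \<Longrightarrow> y \<noteq> z \<Longrightarrow> x \<noteq> z \<Longrightarrow>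
      (\<And>d. d \<in> colour_class H c k \<Longrightarrow> d \<inter> {x, y, z} \<noteq> {} \<Longrightarrow> d = {x, y} \<or> d = {y, z}) \<Longrightarrow>
      \<not> ({x} \<in> H \<and> {y} \<in> H \<and> {z} \<in> H)"
begin

text \<open>The edge along which a stack vertex was entered, with the pendant edge in this role at
  the root. Thus \<open>low i\<close> and \<open>low (Suc i)\<close> are two different edges at
  every vertex \<open>xs ! i\<close> below the top.\<close>

definition low :: "nat \<Rightarrow> 'a set" where
  "low i = (if i = 0 then {xs ! 0} else {xs ! (i - 1), xs ! i})"

lemma low_Suc [simp]: "low (Suc i) = {xs ! i, xs ! Suc i}"
  by (simp add: low_def)

lemma low_in: "i < length xs \<Longrightarrow> low i \<in> H"
  using root path[of "i - 1"] by (auto simp: low_def)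

lemma nth_in_low [simp]: "xs ! i \<in> low i"
  by (simp add: low_def)

lemma nth_in_low_le: "xs ! j \<in> low i \<Longrightarrow> i < length xs \<Longrightarrow> j < length xs \<Longrightarrow> j \<le> i"
  using distinct_stack by (auto simp: low_def nth_eq_iff_index_eq split: if_splits)

lemma low_neq: "Suc i < length xs \<Longrightarrow> low i \<noteq> low (Suc i)"
  using nth_in_low_le[of "Suc i" i] nth_in_low[of "Suc i"] by fastforce

lemma interior_degree: "Suc i < length xs \<Longrightarrow> 2 \<le> degree H (xs ! i)"
  using degree_ge2[OF fin low_in[of i] low_in[of "Suc i"], of "xs ! i"] low_neq[of i] by simp

lemma interior_cases:
  assumes "Suc i < length xs" "degree H (xs ! i) = 2" "e \<in> H" "xs ! i \<in> e"
  shows "e = low i \<or> e = {xs ! i, xs ! Suc i}"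
  using degree_2_cases[OF fin assms(2) low_in low_in _ _ low_neq[OF assms(1)] assms(3,4)] assms(1)
  by simp

lemma low_pairD: "{x, y} = low i \<Longrightarrow> x \<noteq> y \<Longrightarrow> x = xs ! i \<Longrightarrow> i < length xs \<Longrightarrow> 0 < i \<and> y = xs ! (i - 1)"
  by (auto simp: low_def doubleton_eq_iff split: if_splits)

text \<open>Pairs which the invariant tolerates only because both ends have degree 2: the next edge at either
  end has to receive the colour of the pair.\<close>
definition defect :: "bool \<Rightarrow> 'a \<Rightarrow> 'a \<Rightarrow> bool" where
  "defect k x y \<longleftrightarrow> lone (colour_class H c k) x y \<and> degree H x = 2 \<and> degree H y = 2 \<and>
    ((\<exists>z. z \<notin> {x, y} \<and> {x, z} \<in> H \<and> {y, z} \<in> H) \<or>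
     (\<exists>z w. lone (colour_class H c k) z w \<and> {x, y} \<inter> {z, w} = {} \<and> {x, z} \<in> H \<and> {y, w} \<in> H) \<or>
     ({x} \<in> H \<and> {y} \<in> H))"

lemma defect_sym: 
  assumes "defect k x y" shows "defect k y x"
proof -
  let ?D = "colour_class H c k"
  have "\<exists>z. z \<notin> {y, x} \<and> {y, z} \<in> H \<and> {x, z} \<in> H" if "\<exists>z. z \<notin> {x, y} \<and> {x, z} \<in> H \<and> {y, z} \<in> H"
    using that by blast
  moreover have "\<exists>w z. lone ?D w z \<and> {y, x} \<inter> {w, z} = {} \<and> {y, w} \<in> H \<and> {x, z} \<in> H"
    if h: "\<exists>z w. lone ?D z w \<and> {x, y} \<inter> {z, w} = {} \<and> {x, z} \<in> H \<and> {y, w} \<in> H"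
  proof -
    obtain z w where "lone ?D z w" "{x, y} \<inter> {z, w} = {}" "{x, z} \<in> H" "{y, w} \<in> H"
      using h by blast
    moreover have "{y, x} \<inter> {w, z} = {}" using calculation(2) by auto
    ultimately show ?thesis using lone_sym[of ?D z w] by metis
  qed
  moreover have "lone ?D y x" using assms lone_sym[of ?D x y] unfolding defect_def by blast
  ultimately show ?thesis
    using assms unfolding defect_def by satx
qed

lemma nth_inj: "i < length xs \<Longrightarrow> j < length xs \<Longrightarrow> xs ! i = xs ! j \<longleftrightarrow> i = j"
  using distinct_stack by (simp add: nth_eq_iff_index_eq)

text \<open>If both ends were below the top, degree 2 would leave them only the edges of the stack
  path. The third vertex of a triangle would then lie both below and above the pair, half-edges at
  both ends are impossible because only the root can be entered by one, and the opposite side of a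
  4-cycle would be a one-edge component joining stack positions that are not adjacent, against
  \<open>consecutive\<close>.\<close>

lemma defect_interior:
  assumes d: "defect k (xs ! i) b" and i: "Suc i < length xs"
  shows "b = last xs"
proof -
  let ?a = "xs ! i"
  have l: "lone (colour_class H c k) ?a b" and da: "degree H ?a = 2" and db: "degree H b = 2"
    using d by (auto simp: defect_def)
  have ab: "{?a, b} \<in> H" "?a \<noteq> b" using l by (auto simp: lone_def)
  note ca = interior_cases[OF i da]
  have il: "i < length xs" using i by simp
  consider "{?a, b} = low i" | "b = xs ! Suc i"
    using ca[OF ab(1)] ab(2) by (auto simp: doubleton_eq_iff)
  then show ?thesis
  proof cases
    case 1
    then have i0: "0 < i" and b: "b = xs ! (i - 1)" using low_pairD[OF 1 ab(2) refl il] by auto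
    have ii: "Suc (i - 1) = i" using i0 by simp
    have cb: "e = low (i - 1) \<or> e = {b, ?a}" if "e \<in> H" "b \<in> e" for e
      using interior_cases[of "i - 1" e] that db b i0 i by auto
    have nz: "z = xs ! Suc i" if "{?a, z} \<in> H" "z \<noteq> b" "z \<noteq> ?a" for z
    proof -
      have "{?a, z} \<noteq> low i" using 1 that ab(2) by (auto simp: doubleton_eq_iff)
      then show ?thesis using ca[OF that(1)] that by (auto simp: doubleton_eq_iff)
    qed
    have "{?a} \<notin> H"
    proof
      assume "{?a} \<in> H"
      then have "{?a} = {?a, b} \<or> {?a} = {?a, xs ! Suc i}" using ca[of "{?a}"] 1 by auto
      then show False using ab(2) nth_inj[of i "Suc i"] i by auto
    qed
    then consider z where "z \<notin> {?a, b}" "{?a, z} \<in> H" "{b, z} \<in> H" |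
      z w where "lone (colour_class H c k) z w" "{?a, b} \<inter> {z, w} = {}" "{?a, z} \<in> H" "{b, w} \<in> H"
      using d unfolding defect_def by blast
    then show ?thesis
    proof cases
      case (1 z)
      then have "z = xs ! Suc i" using nz by auto
      then have "z \<notin> low (i - 1)" using nth_in_low_le[of "Suc i" "i - 1"] i by fastforce
      then have "{b, z} \<noteq> low (i - 1)" by blast
      then have "z = ?a" using cb[of "{b, z}"] 1 by (auto simp: doubleton_eq_iff)
      then show ?thesis using 1 by auto
    next
      case (2 z w)
      then have z: "z = xs ! Suc i" using nz by auto
      have "{b, w} = low (i - 1)" using cb[of "{b, w}"] 2 by (auto simp: doubleton_eq_iff)
      then have i1: "0 < i - 1 \<and> w = xs ! (i - 1 - 1)" 
        using low_pairD[of b w "i - 1"] b 2 i by auto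
      then have "Suc i = Suc (i - 1 - 1)"
        using consecutive[of k "i - 1 - 1" "Suc i"] lone_sym[OF 2(1)] z i by auto
      then show ?thesis using i1 by auto
    qed
  next
    case 2
    show ?thesis
    proof (cases "Suc (Suc i) < length xs")
      case False
      then have "Suc i = length xs - 1" using i by simp
      then show ?thesis using 2 by (metis last_conv_nth list.size(3) not_less_zero i)
    next
      case True
      have cb: "e = {?a, b} \<or> e = {b, xs ! Suc (Suc i)}" if "e \<in> H" "b \<in> e" for e
        using interior_cases[of "Suc i" e] that db 2 True by auto
      have neq: "b \<noteq> xs ! Suc (Suc i)" "?a \<noteq> xs ! Suc (Suc i)"
        using 2 nth_inj[of _ "Suc (Suc i)"] True by auto
      have low_z: "{?a, z} = low i" if "{?a, z} \<in> H" "z \<noteq> b" for z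
        using ca[OF that(1)] that 2 by (auto simp: doubleton_eq_iff)
      have "{b} \<notin> H" 
        using cb[of "{b}"] ab(2) neq by auto
      then consider z where "z \<notin> {?a, b}" "{?a, z} \<in> H" "{b, z} \<in> H" |
        z w where "lone (colour_class H c k) z w" "{?a, b} \<inter> {z, w} = {}" "{?a, z} \<in> H" "{b, w} \<in> H"
        using d unfolding defect_def by blast
      then show ?thesis
      proof cases
        case (1 z)
        then have "z = xs ! Suc (Suc i)" using cb[of "{b, z}"] by (auto simp: doubleton_eq_iff)
        moreover have "z \<in> low i" using low_z[of z] 1 by auto
        ultimately show ?thesis using nth_in_low_le[of "Suc (Suc i)" i] True by auto
      next
        case (2 z w)
        then have w: "w = xs ! Suc (Suc i)" using cb[of "{b, w}"] by (auto simp: doubleton_eq_iff)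
        have z: "0 < i \<and> z = xs ! (i - 1)" using low_z[of z] 2 low_pairD[of ?a z i] il by auto
        then have "Suc (Suc i) = Suc (i - 1)"
          using 2(1) w True by (intro consecutive[of k]) simp_all
        then show ?thesis using z by simp
      qed
    qed
  qed
qed

text \<open>Degree 2 makes \<open>b'\<close> the third vertex of the triangle. The edge
  \<open>{b, b'}\<close> has one of the two colours and so touches the one-edge component of that
  colour.\<close>

lemma defect_triangle_unique:
  assumes p: "lone (colour_class H c k) p b" "lone (colour_class H c k') p b'" "k \<noteq> k'"
    and d: "degree H p = 2" and z: "z \<notin> {p, b}" "{p, z} \<in> H" "{b, z} \<in> H"
  shows False
proof -
  have bb: "{p,b} \<in> colour_class H c k" "{p,b'} \<in> colour_class H c k'" "p \<noteq> b" "p \<noteq> b'"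
    using p by (simp_all add: lone_def)
  then have bb: "b \<noteq> b'" "{p,b} \<in> H" "{p,b'} \<in> H" "p \<noteq> b" "p \<noteq> b'"
    using p(3) by auto
  have "z = b'" using degree_2_cases[OF fin d bb(2,3) _ _ _ z(2)] bb z by (auto simp: doubleton_eq_iff)
  then have "{b, b'} \<in> H" using z by simp
  moreover have "c {b, b'} = k \<or> c {b, b'} = k'" using p(3) by auto
  ultimately have "{b, b'} = {p, b} \<or> {b, b'} = {p, b'}"
    using lone_eq[OF p(1), of "{b,b'}"] lone_eq[OF p(2), of "{b,b'}"] by auto
  then show False using bb by (simp add: doubleton_eq_iff)
qed

lemma defect_colour_unique:
  assumes p: "p = last xs" "xs \<noteq> []" and d: "defect k p b" and d': "defect k' p b'"
  shows "k = k'"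
proof (rule ccontr)
  assume kk: "k \<noteq> k'"
  have l: "lone (colour_class H c k) p b" and l': "lone (colour_class H c k') p b'"
    and dp: "degree H p = 2" and db: "degree H b = 2" and db': "degree H b' = 2"
    using d d' by (auto simp: defect_def)
  have bb: "b \<noteq> b'" "{p,b} \<in> H" "{p,b'} \<in> H" "p \<noteq> b" "p \<noteq> b'"
    using l l' kk by (auto simp: lone_def)
  have cp: "e = {p, b} \<or> e = {p, b'}" if "e \<in> H" "p \<in> e" for e
    using degree_2_cases[OF fin dp bb(2,3) _ _ _ that] bb by (auto simp: doubleton_eq_iff)
  have "{p} \<notin> H" using cp[of "{p}"] bb by auto
  then obtain z w where zw: "lone (colour_class H c k) z w" "{p, b} \<inter> {z, w} = {}" "{p, z} \<in> H" "{b, w} \<in> H"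
    using d defect_triangle_unique[OF l l' kk dp] unfolding defect_def by blast
  obtain z' w' where zw': "lone (colour_class H c k') z' w'" "{p, b'} \<inter> {z', w'} = {}" "{p, z'} \<in> H" "{b', w'} \<in> H"
    using \<open>{p} \<notin> H\<close> d' defect_triangle_unique[OF l' l kk[symmetric] dp] unfolding defect_def by blast
  have z: "z = b'" "z' = b" using cp[OF zw(3)] cp[OF zw'(3)] zw(2) zw'(2) by (auto simp: doubleton_eq_iff)
  have bw: "{b', w} \<in> H" "{b, w'} \<in> H" using zw(1) zw'(1) z by (auto simp: lone_def)
  have cb: "e = {p, b} \<or> e = {b, w}" if "e \<in> H" "b \<in> e" for e
    using degree_2_cases[OF fin db bb(2) zw(4) _ _ _ that] zw(2) bb by (auto simp: doubleton_eq_iff)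
  have cb': "e = {p, b'} \<or> e = {b', w}" if "e \<in> H" "b' \<in> e" for e
    using degree_2_cases[OF fin db' bb(3) bw(1) _ _ _ that] zw(2) bb by (auto simp: doubleton_eq_iff)
  have w: "w' = w" using cb'[OF zw'(4)] zw'(2) by (auto simp: doubleton_eq_iff)
  \<comment> \<open>The vertex \<open>w\<close> ends a one-edge component in each of the two
    colours, and every edge has one of these colours.\<close>
  have cw: "e = {b', w} \<or> e = {b, w}" if "e \<in> H" "w \<in> e" for e
    using lone_eq[OF zw(1), of e] lone_eq[OF zw'(1), of e] that kk z w by auto
  have "w \<noteq> b'" using zw(1) z by (auto simp: lone_def)
  let ?C = "{p, b, b', w}"
  have C: "e \<subseteq> ?C \<and> card e = 2" if "e \<in> H" "e \<inter> ?C \<noteq> {}" for e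
  proof -
    have "p \<in> e \<or> b \<in> e \<or> b' \<in> e \<or> w \<in> e" using that(2) by auto
    then have "e = {p, b} \<or> e = {p, b'} \<or> e = {b, w} \<or> e = {b', w}"
      using cp[OF that(1)] cb[OF that(1)] cb'[OF that(1)] cw[OF that(1)] by metis
    moreover have "b \<noteq> w" using zw(2) by auto
    ultimately show ?thesis using bb(4,5) \<open>w \<noteq> b'\<close> by (elim disjE) simp_all
  qed
  \<comment> \<open>Here \<open>j\<close> counts positions from the top downwards. No edge leaves
    \<open>?C\<close>, so the root lies in it; but the pendant edge at the root is a singleton,
    while all edges meeting \<open>?C\<close> have two ends.\<close>
  have "j < length xs \<Longrightarrow> xs ! (length xs - 1 - j) \<in> ?C" for j
  proof (induction j)
    case 0
    then show ?case using p by (simp add: last_conv_nth)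
  next
    case (Suc j)
    let ?i = "length xs - 1 - Suc j"
    have i: "Suc ?i = length xs - 1 - j" using Suc.prems by simp
    have "{xs ! ?i, xs ! Suc ?i} \<in> H" using path[of ?i] i Suc.prems by simp
    moreover have "xs ! Suc ?i \<in> ?C" using Suc i by simp
    ultimately have "{xs ! ?i, xs ! Suc ?i} \<subseteq> ?C" using C[of "{xs ! ?i, xs ! Suc ?i}"] by blast
    then show ?case by simp
  qed
  from this[of "length xs - 1"] have "xs ! 0 \<in> ?C" using p by simp
  then have "{xs ! 0} \<inter> ?C \<noteq> {}" by blast
  then have "card {xs ! 0} = 2" using C[OF root[OF p(2)]] by blast
  then show False by simp
qed

end

section \<open>The colour demanded by the top of the stack\<close>

context stack_colouring
begin

lemma interior_both: "Suc i < length xs \<Longrightarrow> \<exists>e\<in>H. xs ! i \<in> e \<and> c e = k"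
  by (intro both_colours interior_degree)

lemma butlast_nth: "x \<in> set (butlast xs) \<Longrightarrow> \<exists>i. Suc i < length xs \<and> x = xs ! i"
  by (auto simp: in_set_conv_nth nth_butlast less_diff_conv)

lemma last_nth: "xs \<noteq> [] \<Longrightarrow> last xs = xs ! (length xs - 1)"
  by (simp add: last_conv_nth)

lemma last_notin_butlast: "xs \<noteq> [] \<Longrightarrow> last xs \<notin> set (butlast xs)"
  using distinct_stack by (metis append_butlast_last_id distinct_append disjoint_iff list.set_intros(1))

lemma stack_covered: "x \<in> set xs \<Longrightarrow> \<exists>e\<in>H. x \<in> e"
  by (metis in_set_conv_nth low_in nth_in_low)

lemma last_degree: "xs \<noteq> [] \<Longrightarrow> 1 \<le> degree H (last xs)"
  using stack_covered[of "last xs"] degree_pos[OF fin] by auto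

text \<open>A top of degree 1 demands the colour it lacks and lies in no \<open>defect\<close>,
  which requires degree 2. Any other top has demands of a single colour by
  \<open>defect_colour_unique\<close>, and without demands any colour serves.\<close>

lemma need_exists:
  assumes "xs \<noteq> []"
  shows "\<exists>k0. (degree H (last xs) = 1 \<longrightarrow> (\<forall>e\<in>H. last xs \<in> e \<longrightarrow> c e \<noteq> k0)) \<and>
    (\<forall>k b. defect k (last xs) b \<longrightarrow> k = k0)"
proof (cases "degree H (last xs) = 1")
  case True
  obtain e where e: "e \<in> H" "last xs \<in> e" using stack_covered[of "last xs"] assms by auto
  have "c f \<noteq> (\<not> c e)" if "f \<in> H" "last xs \<in> f" for f
    using degree_1_unique[OF True e that] by simp
  then show ?thesis using True by (intro exI[of _ "\<not> c e"]) (simp add: defect_def)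
next
  case False
  show ?thesis
  proof (cases "\<exists>k b. defect k (last xs) b")
    case True
    then obtain k b where "defect k (last xs) b" by blast
    then have "\<forall>k' b'. defect k' (last xs) b' \<longrightarrow> k' = k"
      using defect_colour_unique[OF refl assms] by blast
    then show ?thesis using False by blast
  next
    case none: False
    then show ?thesis using False by blast
  qed
qed

lemma defect_last:
  assumes "defect k a b" "x \<in> {a, b}" "x \<in> set xs"
  shows "last xs \<in> {a, b}"
proof -
  obtain i where i: "i < length xs" "x = xs ! i" using assms(3) by (metis in_set_conv_nth)
  show ?thesis
  proof (cases "Suc i < length xs")
    case True
    then have "defect k (xs ! i) b' \<Longrightarrow> b' = last xs" for b'
      using defect_interior by blast
    then show ?thesis using assms(1,2) defect_sym[OF assms(1)] i by auto
  next
    case False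
    then have "i = length xs - 1" using i by simp
    moreover have "xs \<noteq> []" using i by auto
    ultimately have "x = last xs" using i last_nth by simp
    then show ?thesis using assms(2) by simp
  qed
qed

end

text \<open>The search visits \<open>v\<close>, whose visited neighbours are the top of the stack and the set \<open>A\<close>; \<open>B\<close> tells
  whether \<open>v\<close> carries a half-edge, and \<open>k0\<close> is the colour demanded by the top of the stack.\<close>
locale colouring_extension = stack_colouring +
  fixes v :: 'a and A :: "'a set" and B k0 :: bool and g :: "'a \<Rightarrow> bool"
  assumes nonempty: "xs \<noteq> []"
    and new: "e \<in> H \<Longrightarrow> v \<notin> e"
    and below_top: "A \<subseteq> set (butlast xs)"
    and need_leaf: "degree H (last xs) = 1 \<Longrightarrow> e \<in> H \<Longrightarrow> last xs \<in> e \<Longrightarrow> c e \<noteq> k0"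
    and need_defect: "defect k (last xs) b \<Longrightarrow> k = k0"
    and g_last: "g (last xs) = k0"
    and g_single: "A = {a} \<Longrightarrow> g a \<noteq> k0"
    and g_many: "A \<noteq> {} \<Longrightarrow> (\<And>a. A \<noteq> {a}) \<Longrightarrow> \<exists>x\<in>A. g x = k"
    and g_lone: "lone (colour_class H c k) x y \<Longrightarrow> x \<in> insert (last xs) A \<Longrightarrow>
      y \<in> insert (last xs) A \<Longrightarrow> g x = k \<or> g y = k"
begin

abbreviation "p \<equiv> last xs"
abbreviation "N \<equiv> insert p A"

definition "H' = H \<union> (\<lambda>x. {v, x}) ` N \<union> (if B then {{v}} else {})"

text \<open>\<open>the_elem\<close> extracts the other end of a new edge. With \<open>A\<close>
  empty the half-edge at \<open>v\<close> supplies the colour that \<open>{v, p}\<close> lacks.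
  Otherwise the edges at \<open>v\<close> already have both colours, and the half-edge repeats
  \<open>k0\<close> so that \<open>{v, p}\<close> is not a one-edge component.\<close>

definition "c' e = (if v \<notin> e then c e else if e = {v} then (k0 \<longleftrightarrow> A \<noteq> {}) else g (the_elem (e - {v})))"

lemma p_in: "p \<in> set xs" using nonempty by simp

lemma N_stack: "N \<subseteq> set xs" using below_top p_in by (auto dest: in_set_butlastD)

lemma v_stack: "v \<notin> set xs" using stack_covered new by blast

lemma v_N: "v \<notin> N" using N_stack v_stack by blast

lemma p_A: "p \<notin> A" using below_top last_notin_butlast nonempty by blast

lemma finite_A: "finite A" using below_top finite_subset by blast

lemma c'_old [simp]: "e \<in> H \<Longrightarrow> c' e = c e"
  using new by (simp add: c'_def)

lemma c'_new [simp]: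
  assumes "x \<in> N" shows "c' {v, x} = g x"
proof -
  have "x \<noteq> v" using assms v_N by blast
  then have "{v, x} - {v} = {x}" "{v, x} \<noteq> {v}" by auto
  then show ?thesis by (simp add: c'_def)
qed

lemma c'_half [simp]: "c' {v} = (k0 \<longleftrightarrow> A \<noteq> {})"
  by (simp add: c'_def)

lemma old_in [simp]: "e \<in> H \<Longrightarrow> e \<in> H'" by (simp add: H'_def)

lemma new_in [simp]: "x \<in> N \<Longrightarrow> {v, x} \<in> H'" unfolding H'_def by blast

lemma half_in: "{v} \<in> H' \<longleftrightarrow> B"
proof -
  have "{v} \<notin> H" using new by blast
  moreover have "{v} \<notin> (\<lambda>x. {v, x}) ` N" using v_N by auto
  ultimately show ?thesis by (simp add: H'_def)
qed

lemma H'_v: "e \<in> H' \<Longrightarrow> v \<in> e \<Longrightarrow> (\<exists>x\<in>N. e = {v, x}) \<or> B \<and> e = {v}"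
  unfolding H'_def using new by (auto split: if_splits)

lemma H'_old: "e \<in> H' \<Longrightarrow> v \<notin> e \<Longrightarrow> e \<in> H"
  unfolding H'_def by (auto split: if_splits)

lemma edge_vD: "{v, x} \<in> H' \<Longrightarrow> x \<noteq> v \<Longrightarrow> x \<in> N"
  using H'_v[of "{v, x}"] v_N by (auto simp: doubleton_eq_iff)

lemma A_interior: "x \<in> A \<Longrightarrow> \<exists>e\<in>H. x \<in> e \<and> c e = k"
  using below_top butlast_nth interior_both by blast

lemma A_degree: "x \<in> A \<Longrightarrow> 2 \<le> degree H x"
  using below_top butlast_nth interior_degree by blast

lemma finite_H': "finite H'"
  using fin finite_A by (simp add: H'_def)

lemma degree_other:
  assumes "x \<noteq> v" "x \<notin> N" shows "degree H' x = degree H x"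
proof -
  have "e \<in> H' \<and> x \<in> e \<longleftrightarrow> e \<in> H \<and> x \<in> e" for e
  proof
    assume e: "e \<in> H' \<and> x \<in> e"
    then have "v \<notin> e" using H'_v[of e] assms by auto
    then show "e \<in> H \<and> x \<in> e" using H'_old e by blast
  qed simp
  then show ?thesis by (simp add: degree_def)
qed

lemma degree_last: "degree H' p = Suc (degree H p)"
proof -
  have "{e \<in> H'. p \<in> e} = insert {v, p} {e \<in> H. p \<in> e}"
    using H'_old H'_v v_N by (auto simp: doubleton_eq_iff)
  moreover have "{v, p} \<notin> {e \<in> H. p \<in> e}" using new by blast
  ultimately show ?thesis using fin by (simp add: degree_def)
qed

lemma degree_v:
  shows "A = {} \<Longrightarrow> B \<Longrightarrow> degree H' v = 2"
    and "A = {} \<Longrightarrow> \<not> B \<Longrightarrow> degree H' v = 1"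
    and "A = {a} \<Longrightarrow> \<not> B \<Longrightarrow> degree H' v = 2"
proof -
  have *: "{e \<in> H'. v \<in> e} = (\<lambda>x. {v, x}) ` N \<union> (if B then {{v}} else {})"
    using new unfolding H'_def by (auto split: if_splits)
  have v: "p \<noteq> v" "A = {a} \<Longrightarrow> a \<noteq> v" "A = {a} \<Longrightarrow> a \<noteq> p" using v_N p_A by auto
  show "A = {} \<Longrightarrow> B \<Longrightarrow> degree H' v = 2" "A = {} \<Longrightarrow> \<not> B \<Longrightarrow> degree H' v = 1" 
    using v unfolding degree_def * by (auto simp: card_insert_if doubleton_eq_iff)
  show "A = {a} \<Longrightarrow> \<not> B \<Longrightarrow> degree H' v = 2" 
    using v unfolding degree_def * by (auto simp: card_insert_if doubleton_eq_iff)
qed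

lemma lone_old:
  assumes "lone (colour_class H' c' k) x y" "x \<noteq> v" "y \<noteq> v"
  shows "lone (colour_class H c k) x y" and "z \<in> N \<Longrightarrow> z \<in> {x, y} \<Longrightarrow> g z \<noteq> k"
proof -
  have xy: "{x, y} \<in> H" using assms H'_old by (auto simp: lone_def)
  show "lone (colour_class H c k) x y"
    using assms(1) xy unfolding lone_def by auto
  show "g z \<noteq> k" if "z \<in> N" "z \<in> {x, y}"
  proof
    assume "g z = k"
    then have "{v, z} = {x, y}" using lone_eq[OF assms(1), of "{v, z}"] that by auto
    then show False using assms(2,3) by (auto simp: doubleton_eq_iff)
  qed
qed

text \<open>An ancestor in \<open>A\<close> already meets edges of either colour, so an edge to it
  never becomes a one-edge component. Only the edge to the top can, and then the top had a single
  edge, of the other colour. Two ancestors in \<open>A\<close>, or one together with a half-edge,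
  would put a second edge of colour \<open>k0\<close> at \<open>v\<close>.\<close>

lemma lone_new:
  assumes l: "lone (colour_class H' c' k) v y"
  shows "y = p" and "k = k0" and "degree H p = 1" and "A = {} \<or> (\<exists>a. A = {a}) \<and> \<not> B"
proof -
  have vy: "v \<noteq> y" "{v, y} \<in> H'" "c' {v, y} = k" using l by (auto simp: lone_def)
  then have y: "y \<in> N" using edge_vD by blast
  then have gy: "g y = k" using vy by simp
  have no: "c e \<noteq> k" if "e \<in> H" "y \<in> e" for e
  proof
    assume "c e = k"
    then have "e = {v, y}" using lone_eq[OF l, of e] that by auto
    then show False using new[OF that(1)] by simp
  qed
  show yp: "y = p" using y no A_interior[of y k] by blast
  then show k: "k = k0" using gy g_last by simp
  show "degree H p = 1"
    using both_colours[of p k] no yp last_degree nonempty by force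
  show "A = {} \<or> (\<exists>a. A = {a}) \<and> \<not> B"
  proof (rule ccontr)
    assume neg: "\<not> ?thesis"
    then have A: "A \<noteq> {}" by blast
    show False
    proof (cases "\<exists>a. A = {a}")
      case True
      then have "{v} \<in> colour_class H' c' k" using neg A k half_in by auto
      then have "{v} = {v, y}" using lone_eq[OF l] by blast
      then show False using vy by auto
    next
      case False
      then obtain x where x: "x \<in> A" "g x = k" using g_many[of k] A by blast
      then have "{v, x} \<in> colour_class H' c' k" by simp
      then have "{v, x} = {v, y}" using lone_eq[OF l] by blast
      then show False using x yp p_A vy by (auto simp: doubleton_eq_iff)
    qed
  qed
qed

text \<open>This settles the new one-edge components in \<open>triangle\<close>,
  \<open>square\<close> and \<open>half_edges\<close> at once: each of these configurations gives
  \<open>v\<close> a further edge, and by \<open>lone_new\<close> there can be only one.\<close>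

lemma lone_new_degrees:
  assumes l: "lone (colour_class H' c' k) v y" and "(z \<noteq> y \<and> z \<noteq> v \<and> {v, z} \<in> H') \<or> {v} \<in> H'"
  shows "degree H' v = 2 \<and> degree H' y = 2"
proof -
  have y: "y = p" "degree H p = 1" and A: "A = {} \<or> (\<exists>a. A = {a}) \<and> \<not> B"
    using lone_new[OF l] by auto
  have "degree H' y = 2" using y degree_last by simp
  moreover have "degree H' v = 2"
    using assms(2)
  proof
    assume z: "z \<noteq> y \<and> z \<noteq> v \<and> {v, z} \<in> H'"
    then have "z \<in> A" using edge_vD y by blast
    then obtain a where "A = {a}" "\<not> B" using A by blast
    then show ?thesis using degree_v(3) by blast
  next
    assume "{v} \<in> H'"
    then have "B" by (simp add: half_in)
    then show ?thesis using degree_v(1) A by blast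
  qed
  ultimately show ?thesis by simp
qed

text \<open>A defect touched by the new edges contains the top, so its colour is \<open>k0\<close>,
  and the edge \<open>{v, p}\<close> of that colour destroys the one-edge component. A defect that
  is still a one-edge component was therefore not touched and keeps its degrees.\<close>

lemma old_defect:
  assumes l: "lone (colour_class H' c' k) x y" "x \<noteq> v" "y \<noteq> v" and d: "defect k x y"
  shows "degree H' x = 2 \<and> degree H' y = 2"
proof -
  have "x \<notin> N \<and> y \<notin> N"
  proof (rule ccontr)
    assume "\<not> ?thesis"
    then have p: "p \<in> {x, y}" using defect_last[OF d] N_stack by blast
    then have "k = k0" using need_defect d defect_sym[OF d] by blast
    then show False using lone_old(2)[OF l, of p] p g_last by simp
  qed
  then show ?thesis using d degree_other assms(2,3) by (simp add: defect_def)
qed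

lemma both_colours':
  assumes "2 \<le> degree H' w" shows "\<exists>e\<in>H'. w \<in> e \<and> c' e = k"
proof (cases "w = v")
  case True
  have p: "{v, p} \<in> H'" "c' {v, p} = k0" using g_last by simp_all
  have two: "\<exists>e\<in>H'. w \<in> e \<and> c' e = k" if f: "f \<in> H'" "v \<in> f" "c' f \<noteq> k0" for f
  proof (cases "k = k0")
    case eq: True
    show ?thesis using p True unfolding eq by (intro bexI[of _ "{v, p}"] conjI) simp_all
  next
    case False
    then have "c' f = k" using f(3) by blast
    then show ?thesis using f(1,2) True by blast
  qed
  consider "A = {}" | a where "A = {a}" | "A \<noteq> {}" "\<And>a. A \<noteq> {a}" by blast
  then show ?thesis
  proof cases
    case 1
    from 1 have "B" using degree_v(2) assms True by fastforce
    then have "{v} \<in> H'" "c' {v} \<noteq> k0" using 1 half_in c'_half by blast+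
    then show ?thesis using two by blast
  next
    case (2 a)
    from 2 have "a \<in> N" by blast
    then have "{v, a} \<in> H'" "c' {v, a} \<noteq> k0" using g_single[OF 2] by simp_all
    then show ?thesis using two by blast
  next
    case 3
    then obtain x where "x \<in> A" "g x = k" using g_many by blast
    then show ?thesis using True by (intro bexI[of _ "{v, x}"]) auto
  qed
next
  case False
  show ?thesis
  proof (cases "2 \<le> degree H w")
    case True
    then obtain e where "e \<in> H" "w \<in> e" "c e = k" using both_colours by blast
    then show ?thesis by (intro bexI[of _ e]) auto
  next
    case low: False
    then have "w \<in> N" using degree_other[OF False] assms by force
    \<comment> \<open>Only the top can rise from degree 1 to degree 2; its old edge does not have
      colour \<open>k0\<close>, and its new one does.\<close>
    then have w: "w = p" using A_degree low by blast
    then have d: "degree H p = 1" using low last_degree nonempty by simp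
    obtain e where e: "e \<in> H" "p \<in> e" using stack_covered[OF p_in] by blast
    then have ce: "c e \<noteq> k0" using need_leaf d by blast
    show ?thesis
    proof (cases "k = k0")
      case eq: True
      show ?thesis using g_last w unfolding eq by (intro bexI[of _ "{v, p}"] conjI) simp_all
    next
      case False
      then have "c e = k" using ce by blast
      then show ?thesis using e w by (intro bexI[of _ e] conjI) simp_all
    qed
  qed
qed

lemma triangle':
  assumes l: "lone (colour_class H' c' k) x y" and z: "{x, z} \<in> H'" "{y, z} \<in> H'" "z \<notin> {x, y}"
  shows "degree H' x = 2 \<and> degree H' y = 2"
proof -
  consider "x = v" | "y = v" | "x \<noteq> v" "y \<noteq> v" by blast
  then show ?thesis
  proof cases
    case 1
    then show ?thesis using lone_new_degrees[of k y z] l z by auto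
  next
    case 2
    then show ?thesis using lone_new_degrees[of k x z] lone_sym[OF l] z by auto
  next
    case 3
    note o = lone_old[OF l 3]
    show ?thesis
    proof (cases "z = v")
      case True
      then have "x \<in> N" "y \<in> N" using edge_vD z 3 by (metis insert_commute)+
      then show ?thesis using g_lone[OF o(1)] o(2) by blast
    next
      case False
      then have zz: "{x, z} \<in> H" "{y, z} \<in> H" using z 3 H'_old by auto
      then have "defect k x y"
        using triangle[OF o(1) zz z(3)] o(1) z(3) unfolding defect_def by blast
      then show ?thesis using old_defect[OF l 3] by blast
    qed
  qed
qed

lemma square':
  assumes l: "lone (colour_class H' c' k) x y" and m: "lone (colour_class H' c' k) z w"
    and dis: "{x, y} \<inter> {z, w} = {}" and e: "{x, z} \<in> H'" "{y, w} \<in> H'"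
  shows "degree H' x = 2 \<and> degree H' y = 2 \<or> degree H' z = 2 \<and> degree H' w = 2"
proof -
  consider "x = v" | "y = v" | "z = v" | "w = v" | "x \<noteq> v" "y \<noteq> v" "z \<noteq> v" "w \<noteq> v" by blast
  then show ?thesis
  proof cases
    case 1
    then show ?thesis using lone_new_degrees[of k y z] l dis e by auto
  next
    case 2
    then show ?thesis using lone_new_degrees[of k x w] lone_sym[OF l] dis e by auto
  next
    case 3
    then show ?thesis using lone_new_degrees[of k w x] m dis e by (auto simp: insert_commute)
  next
    case 4
    then show ?thesis using lone_new_degrees[of k z y] lone_sym[OF m] dis e by (auto simp: insert_commute)
  next
    case 5
    note o = lone_old(1)[OF l 5(1,2)] lone_old(1)[OF m 5(3,4)]
    have ee: "{x, z} \<in> H" "{y, w} \<in> H" "{z, x} \<in> H" "{w, y} \<in> H"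
      using e 5 H'_old by (auto simp: insert_commute)
    have dis': "{z, w} \<inter> {x, y} = {}" using dis by blast
    from square[OF o dis ee(1,2)] show ?thesis
    proof
      assume "degree H x = 2 \<and> degree H y = 2"
      then have "defect k x y" using o dis ee unfolding defect_def by blast
      then show ?thesis using old_defect[OF l 5(1,2)] by blast
    next
      assume "degree H z = 2 \<and> degree H w = 2"
      then have "defect k z w" using o dis' ee unfolding defect_def by blast
      then show ?thesis using old_defect[OF m 5(3,4)] by blast
    qed
  qed
qed

lemma half_edges':
  assumes l: "lone (colour_class H' c' k) x y" and h: "{x} \<in> H'" "{y} \<in> H'"
  shows "degree H' x = 2 \<and> degree H' y = 2"
proof -
  consider "x = v" | "y = v" | "x \<noteq> v" "y \<noteq> v" by blast
  then show ?thesis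
  proof cases
    case 1
    then show ?thesis using lone_new_degrees[of k y] l h by auto
  next
    case 2
    then show ?thesis using lone_new_degrees[of k x] lone_sym[OF l] h by auto
  next
    case 3
    note o = lone_old(1)[OF l 3]
    have hh: "{x} \<in> H" "{y} \<in> H" using h 3 H'_old by auto
    then have "defect k x y" using half_edges[OF o hh] o unfolding defect_def by blast
    then show ?thesis using old_defect[OF l 3] by blast
  qed
qed

text \<open>Half-edges at both old vertices would make \<open>{y, z}\<close> a defect, so its colour
  would be the demanded \<open>k0\<close>. But with \<open>A\<close> nonempty the half-edge at
  \<open>v\<close> has colour \<open>k0\<close> too and would belong to the component of the
  cherry.\<close>

lemma cherry_end:
  assumes "{v, y} \<in> colour_class H' c' k" "{y, z} \<in> colour_class H' c' k"
    "{v, z} \<in> H'" "c' {v, z} \<noteq> k" "v \<noteq> y" "y \<noteq> z" "v \<noteq> z"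
    and d: "\<And>d. d \<in> colour_class H' c' k \<Longrightarrow> d \<inter> {v, y, z} \<noteq> {} \<Longrightarrow> d = {v, y} \<or> d = {y, z}"
  shows "\<not> ({v} \<in> H' \<and> {y} \<in> H' \<and> {z} \<in> H')"
proof
  assume h: "{v} \<in> H' \<and> {y} \<in> H' \<and> {z} \<in> H'"
  have N: "y \<in> N" "z \<in> N" using assms edge_vD by auto
  then have A: "A \<noteq> {}" using assms(6) by auto
  have k: "k \<noteq> k0"
  proof
    assume "k = k0"
    then have "{v} \<in> colour_class H' c' k" using h A by simp
    then show False using d[of "{v}"] assms(5,7) by auto
  qed
  have "{y, z} \<in> H" using H'_old assms(2,5,7) by simp
  then have yz: "{y, z} \<in> colour_class H c k" using assms(2) by simp
  have only: "e = {y, z}" if "e \<in> colour_class H c k" "y \<in> e \<or> z \<in> e" for e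
  proof -
    have "e \<in> colour_class H' c' k" using that by simp
    then have "e = {v, y} \<or> e = {y, z}" using d[of e] that(2) by blast
    then show ?thesis using new[of e] that by auto
  qed
  have l: "lone (colour_class H c k) y z" unfolding lone_def using yz only assms(6) by blast
  have "{y} \<in> H" "{z} \<in> H" using h H'_old assms(5,7) by simp_all
  then have df: "defect k y z" using half_edges[OF l] l unfolding defect_def by blast
  then have "p \<in> {y, z}" using defect_last[OF df, of y] N N_stack by blast
  then have "k = k0" using need_defect df defect_sym[OF df] by blast
  then show False using k by simp
qed

lemma cherry':
  assumes c: "{x, y} \<in> colour_class H' c' k" "{y, z} \<in> colour_class H' c' k"
    "{x, z} \<in> H'" "c' {x, z} \<noteq> k" "x \<noteq> y" "y \<noteq> z" "x \<noteq> z"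
    and d: "\<And>d. d \<in> colour_class H' c' k \<Longrightarrow> d \<inter> {x, y, z} \<noteq> {} \<Longrightarrow> d = {x, y} \<or> d = {y, z}"
  shows "\<not> ({x} \<in> H' \<and> {y} \<in> H' \<and> {z} \<in> H')"
proof -
  consider "x = v" | "z = v" | "y = v" | "x \<noteq> v" "y \<noteq> v" "z \<noteq> v" by blast
  then show ?thesis
  proof cases
    case 1
    then show ?thesis using cherry_end[of y k z] assms by blast
  next
    case 2
    have "{v, y} \<in> colour_class H' c' k" "{y, x} \<in> colour_class H' c' k" "{v, x} \<in> H'" "c' {v, x} \<noteq> k"
      using c 2 by (simp_all add: insert_commute)
    moreover have "e = {v, y} \<or> e = {y, x}" if "e \<in> colour_class H' c' k" "e \<inter> {v, y, x} \<noteq> {}" for e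
      using d[of e] that 2 by (simp add: insert_commute disj_commute)
    ultimately show ?thesis using cherry_end[of y k x] c 2 by blast
  next
    case 3
    show ?thesis
    proof
      assume h: "{x} \<in> H' \<and> {y} \<in> H' \<and> {z} \<in> H'"
      have N: "x \<in> N" "z \<in> N" using c 3 edge_vD by (auto simp: insert_commute)
      then have g: "g x = k" "g z = k" using c 3 by (auto simp: insert_commute)
      have A: "A \<noteq> {}" using N c(7) by auto
      have "k \<noteq> k0"
      proof
        assume "k = k0"
        then have "{v} \<in> colour_class H' c' k" using h A 3 by simp
        then show False using d[of "{v}"] c 3 by auto
      qed
      \<comment> \<open>As \<open>k\<close> is not \<open>k0\<close>, the end \<open>x\<close> is
        not the top. Being an ancestor, it already meets an old edge of colour \<open>k\<close>,
        which is not part of a cherry centred at \<open>v\<close>.\<close>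
      then have "x \<in> A" using N g g_last by auto
      then obtain e where e: "e \<in> H" "x \<in> e" "c e = k" using A_interior by blast
      then have "e = {x, y} \<or> e = {y, z}" using d[of e] by auto
      then show False using new[OF e(1)] 3 by blast
    qed
  next
    case 4
    have "{x, y} \<in> colour_class H c k" "{y, z} \<in> colour_class H c k" "{x, z} \<in> H" "c {x, z} \<noteq> k"
      using c 4 H'_old by auto
    moreover have "e = {x, y} \<or> e = {y, z}" if "e \<in> colour_class H c k" "e \<inter> {x, y, z} \<noteq> {}" for e
      using d[of e] that by simp
    ultimately have "\<not> ({x} \<in> H \<and> {y} \<in> H \<and> {z} \<in> H)" using cherry[of x y k z] c by blast
    then show ?thesis using H'_old 4 by blast
  qed
qed

lemma extended: "stack_colouring H' c' (xs @ [v])"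
proof
  show "finite H'" by (rule finite_H')
  show "card e = 1 \<or> card e = 2" if "e \<in> H'" for e
  proof (cases "v \<in> e")
    case True
    consider x where "x \<in> N" "e = {v, x}" | "e = {v}" using H'_v[OF \<open>e \<in> H'\<close> True] by blast
    then show ?thesis
    proof cases
      case (1 x)
      then have "x \<noteq> v" using v_N by blast
      then show ?thesis using 1 by simp
    qed simp
  next
    case False
    then show ?thesis using H'_old[OF that] sizes by blast
  qed
  show "distinct (xs @ [v])" using distinct_stack v_stack by simp
  show "{(xs @ [v]) ! 0} \<in> H'" using root[OF nonempty] nonempty by (simp add: nth_append)
  show "{(xs @ [v]) ! i, (xs @ [v]) ! Suc i} \<in> H'" if "Suc i < length (xs @ [v])" for i
  proof (cases "Suc i < length xs")
    case True
    then show ?thesis using path by (simp add: nth_append)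
  next
    case False
    then have "Suc i = length xs" using that by simp
    then have "(xs @ [v]) ! i = p" "(xs @ [v]) ! Suc i = v"
      using nonempty by (auto simp: nth_append last_nth simp flip: \<open>Suc i = length xs\<close>)
    then show ?thesis using new_in[of p] by (simp add: insert_commute)
  qed
  show "j = Suc i" if "lone (colour_class H' c' k) ((xs @ [v]) ! i) ((xs @ [v]) ! j)" "i < j"
    "j < length (xs @ [v])" for k i j
  proof (cases "j < length xs")
    case True
    then have "xs ! i \<noteq> v" "xs ! j \<noteq> v" using that(2) v_stack by auto
    then show ?thesis using consecutive[of k i j] lone_old(1)[of k "xs ! i" "xs ! j"] that True
      by (simp add: nth_append)
  next
    case False
    then have j: "j = length xs" using that by simp
    then have "lone (colour_class H' c' k) v (xs ! i)"
      using lone_sym[OF that(1)] that(2) by (simp add: nth_append)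
    then have "xs ! i = xs ! (length xs - 1)" using lone_new(1) last_nth nonempty by simp
    then show ?thesis using nth_inj[of i "length xs - 1"] that(2) j by simp
  qed
  show "\<exists>e\<in>H'. w \<in> e \<and> c' e = k" if "2 \<le> degree H' w" for w k
    by (rule both_colours'[OF that])
  show "degree H' x = 2 \<and> degree H' y = 2"
    if "lone (colour_class H' c' k) x y" "{x, z} \<in> H'" "{y, z} \<in> H'" "z \<notin> {x, y}" for k x y z
    by (rule triangle'[OF that])
  show "degree H' x = 2 \<and> degree H' y = 2 \<or> degree H' z = 2 \<and> degree H' w = 2"
    if "lone (colour_class H' c' k) x y" "lone (colour_class H' c' k) z w"
      "{x, y} \<inter> {z, w} = {}" "{x, z} \<in> H'" "{y, w} \<in> H'" for k x y z w
    by (rule square'[OF that])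
  show "degree H' x = 2 \<and> degree H' y = 2"
    if "lone (colour_class H' c' k) x y" "{x} \<in> H'" "{y} \<in> H'" for k x y
    by (rule half_edges'[OF that])
  show "\<not> ({x} \<in> H' \<and> {y} \<in> H' \<and> {z} \<in> H')"
    if "{x, y} \<in> colour_class H' c' k" "{y, z} \<in> colour_class H' c' k"
    "{x, z} \<in> H'" "c' {x, z} \<noteq> k" "x \<noteq> y" "y \<noteq> z" "x \<noteq> z"
    "\<And>d. d \<in> colour_class H' c' k \<Longrightarrow> d \<inter> {x, y, z} \<noteq> {} \<Longrightarrow> d = {x, y} \<or> d = {y, z}" for x y z k
    by (rule cherry'[OF that])
qed

end

section \<open>Popping, and colours for the edges to ancestors\<close>

context stack_colouring
begin

lemma popped: "stack_colouring H c (butlast xs)"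
proof
  show "finite H" by (rule fin)
  show "card e = 1 \<or> card e = 2" if "e \<in> H" for e by (rule sizes[OF that])
  show "distinct (butlast xs)" using distinct_stack by (rule distinct_butlast)
  show "{butlast xs ! 0} \<in> H" if "butlast xs \<noteq> []"
    using root that by (cases xs) (auto simp: nth_butlast)
  show "{butlast xs ! i, butlast xs ! Suc i} \<in> H" if "Suc i < length (butlast xs)" for i
    using path[of i] that by (simp add: nth_butlast)
  show "j = Suc i" if "lone (colour_class H c k) (butlast xs ! i) (butlast xs ! j)" "i < j"
    "j < length (butlast xs)" for k i j
    using consecutive[of k i j] that by (simp add: nth_butlast)
  show "\<exists>e\<in>H. w \<in> e \<and> c e = k" if "2 \<le> degree H w" for w k
    by (rule both_colours[OF that])
  show "degree H x = 2 \<and> degree H y = 2"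
    if "lone (colour_class H c k) x y" "{x, z} \<in> H" "{y, z} \<in> H" "z \<notin> {x, y}" for k x y z
    by (rule triangle[OF that])
  show "degree H x = 2 \<and> degree H y = 2 \<or> degree H z = 2 \<and> degree H w = 2"
    if "lone (colour_class H c k) x y" "lone (colour_class H c k) z w"
      "{x, y} \<inter> {z, w} = {}" "{x, z} \<in> H" "{y, w} \<in> H" for k x y z w
    by (rule square[OF that])
  show "degree H x = 2 \<and> degree H y = 2"
    if "lone (colour_class H c k) x y" "{x} \<in> H" "{y} \<in> H" for k x y
    by (rule half_edges[OF that])
  show "\<not> ({x} \<in> H \<and> {y} \<in> H \<and> {z} \<in> H)"
    if "{x, y} \<in> colour_class H c k" "{y, z} \<in> colour_class H c k"
    "{x, z} \<in> H" "c {x, z} \<noteq> k" "x \<noteq> y" "y \<noteq> z" "x \<noteq> z"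
    "\<And>d. d \<in> colour_class H c k \<Longrightarrow> d \<inter> {x, y, z} \<noteq> {} \<Longrightarrow> d = {x, y} \<or> d = {y, z}" for x y z k
    by (rule cherry[OF that])
qed

text \<open>A one-edge component on the stack is destroyed if its end nearer the root repeats the
  colour of the edge leading up the stack. This constrains \<open>g\<close> only at the
  \<open>head\<close> vertices, and two consecutive heads require different colours because their
  components share a vertex. So either both colours occur anyway or some vertex that is not a head
  is free to supply the missing one.\<close>

lemma back_colours_exist:
  assumes ne: "xs \<noteq> []" and A: "A \<subseteq> set (butlast xs)"
  shows "\<exists>g. g (last xs) = k0 \<and> (\<forall>a. A = {a} \<longrightarrow> g a \<noteq> k0) \<and>
    (A \<noteq> {} \<longrightarrow> (\<forall>a. A \<noteq> {a}) \<longrightarrow> (\<forall>k. \<exists>x\<in>A. g x = k)) \<and>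
    (\<forall>k x y. lone (colour_class H c k) x y \<longrightarrow> x \<in> insert (last xs) A \<longrightarrow> y \<in> insert (last xs) A \<longrightarrow>
      g x = k \<or> g y = k)"
proof -
  let ?p = "last xs"
  let ?N = "insert ?p A"
  have pA: "?p \<notin> A" using A last_notin_butlast ne by blast
  consider "A = {}" | a where "A = {a}" | "A \<noteq> {}" "\<And>a. A \<noteq> {a}" by blast
  then show ?thesis
  proof cases
    case 1
    show ?thesis by (rule exI[of _ "\<lambda>_. k0"]) (auto simp: 1 lone_def)
  next
    \<comment> \<open>The top and \<open>a\<close> get opposite colours, so a one-edge component
      consisting of them finds its own colour at one end.\<close>
    case (2 a)
    then have "a \<noteq> ?p" using pA by blast
    then have "(x = ?p \<and> y = a) \<or> (x = a \<and> y = ?p)"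
      if "lone (colour_class H c k) x y" "x \<in> ?N" "y \<in> ?N" for k x y
      using that 2 by (auto simp: lone_def)
    then show ?thesis using 2 \<open>a \<noteq> ?p\<close>
      by (intro exI[of _ "\<lambda>x. if x = ?p then k0 else \<not> k0"]) fastforce
  next
    case 3
    define ix where "ix x = (SOME i. i < length xs \<and> xs ! i = x)" for x
    have ix: "ix (xs ! i) = i" if "i < length xs" for i
      unfolding ix_def using that nth_inj by (intro some_equality) auto
    define f where "f x = (if x = ?p then k0 else c {x, xs ! Suc (ix x)})" for x
    define head where "head x \<longleftrightarrow> xs ! Suc (ix x) \<in> ?N \<and>
      lone (colour_class H c (f x)) x (xs ! Suc (ix x))" for x
    have A_nth: "\<exists>i. Suc i < length xs \<and> x = xs ! i" if "x \<in> A" for x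
      using A that butlast_nth by blast
    have N_nth: "\<exists>i. i < length xs \<and> x = xs ! i" if "x \<in> ?N" for x
      using that A_nth last_nth ne
      by (metis Suc_lessD diff_less insert_iff length_greater_0_conv zero_less_one)
    have ordered: "x \<in> A \<and> head x \<and> f x = k"
      if l: "lone (colour_class H c k) x y" and N: "x \<in> ?N" "y \<in> ?N" and le: "ix x < ix y" for k x y
    proof -
      obtain i j where i: "i < length xs" "x = xs ! i" and j: "j < length xs" "y = xs ! j"
        using N N_nth by blast
      have ij: "i < j" using le ix i j by simp
      then have J: "j = Suc i" using consecutive[of k i j] l i j by simp
      have "x \<noteq> ?p" using nth_inj[of i "length xs - 1"] i j ij last_nth ne by auto
      then have xA: "x \<in> A" using N by blast
      have "f x = c {x, y}" using \<open>x \<noteq> ?p\<close> i j J ix by (simp add: f_def)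
      also have "\<dots> = k" using l by (simp add: lone_def)
      finally show ?thesis using l N(2) i j J ix xA by (simp add: head_def)
    qed
    have ix_neq: "ix x < ix y \<or> ix y < ix x" if "x \<noteq> y" "x \<in> ?N" "y \<in> ?N" for x y
      using that N_nth ix by (metis linorder_neqE_nat)
    have lone_g: "g x = k \<or> g y = k"
      if g: "\<And>x. x \<in> A \<Longrightarrow> head x \<Longrightarrow> g x = f x"
        and l: "lone (colour_class H c k) x y" and N: "x \<in> ?N" "y \<in> ?N" for g k x y
    proof -
      have "x \<noteq> y" using l by (simp add: lone_def)
      then show ?thesis
        using ix_neq[OF _ N] ordered[OF l N] ordered[OF lone_sym[OF l] N(2,1)] g by metis
    qed
    show ?thesis
    proof (cases "\<forall>x\<in>A. head x")
      case True
      \<comment> \<open>The vertex \<open>b\<close> only guarantees that the successor of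
        \<open>a\<close> on the stack lies below the top. The two vertices shown to have different
        colours are \<open>a\<close> and its successor \<open>?b\<close>.\<close>
      obtain a b where ab: "a \<in> A" "b \<in> A" "ix a < ix b"
      proof -
        obtain a where "a \<in> A" using 3 by blast
        moreover obtain b where "b \<in> A" "b \<noteq> a" using 3 calculation by blast
        ultimately show ?thesis using ix_neq[of a b] that by blast
      qed
      obtain i j where i: "Suc i < length xs" "a = xs ! i" and j: "Suc j < length xs" "b = xs ! j"
        using ab A_nth by metis
      have ij: "i < j" using ab ix i j by simp
      let ?b = "xs ! Suc i"
      have h: "?b \<in> ?N" "lone (colour_class H c (f a)) a ?b"
        using True ab i ix by (auto simp: head_def)
      have "?b \<noteq> ?p" using nth_inj[of "Suc i" "length xs - 1"] i j ij last_nth ne by auto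
      then have bA: "?b \<in> A" using h by blast
      then have h': "lone (colour_class H c (f ?b)) ?b (xs ! Suc (Suc i))"
        using True ix i by (auto simp: head_def)
      have "f a \<noteq> f ?b"
      proof
        assume eq: "f a = f ?b"
        then have "{a, ?b} = {?b, xs ! Suc (Suc i)}"
          using h h' lone_eq[OF h(2), of "{?b, xs ! Suc (Suc i)}"] by (simp add: lone_def)
        then have "a = xs ! Suc (Suc i)" by (auto simp: doubleton_eq_iff)
        then show False using nth_inj[of i "Suc (Suc i)"] i j ij by simp
      qed
      then have "\<forall>k. \<exists>x\<in>A. f x = k" using bA ab(1) by (metis (full_types))
      moreover have "f ?p = k0" by (simp add: f_def)
      ultimately show ?thesis using 3 lone_g[of f] by (intro exI[of _ f]) blast
    next
      case False
      then obtain z where z: "z \<in> A" "\<not> head z" by blast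
      obtain w where w: "w \<in> A" "w \<noteq> z" using 3 z by blast
      \<comment> \<open>As \<open>z\<close> is not a \<open>head\<close>, no one-edge component
        constrains its colour, so it can supply the colour that \<open>w\<close> does not.\<close>
      define g where "g = f(z := \<not> f w)"
      have "g x = f x" if "x \<in> A" "head x" for x using that z by (auto simp: g_def)
      then have "\<forall>k x y. lone (colour_class H c k) x y \<longrightarrow> x \<in> ?N \<longrightarrow> y \<in> ?N \<longrightarrow> g x = k \<or> g y = k"
        using lone_g[of g] by blast
      moreover have "g w = f w" "g z = (\<not> f w)" using w by (auto simp: g_def)
      then have "\<forall>k. \<exists>x\<in>A. g x = k" using z(1) w(1) by (metis (full_types))
      moreover have "g ?p = k0" using z pA by (auto simp: g_def f_def)
      ultimately show ?thesis using 3 by (intro exI[of _ g]) blast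
    qed
  qed
qed

end

section \<open>Running the search\<close>

lemma stack_colouring_single: "stack_colouring {{s}} c [s]"
proof -
  have "degree {{s}} v \<le> 1" for v
    unfolding degree_def using card_mono[of "{{s}}" "{e \<in> {{s}}. v \<in> e}"] by auto
  then have deg: "\<not> 2 \<le> degree {{s}} v" for v
    by (metis Suc_1 not_less_eq_eq One_nat_def)
  show ?thesis
    by unfold_locales (use deg in \<open>auto simp: lone_def insert_eq_iff dest: spec\<close>)
qed

text \<open>The last hypothesis says that visited vertices off the stack are finished, hence all
  visited neighbours of a new vertex are on the stack. Working with the induced subgraph on
  \<open>S\<close> means that an edge is coloured when its second end is visited, and a pendant edge
  together with its vertex.\<close>

lemma depth_first_colouring:
  fixes E :: "'a set set"
  assumes fin: "finite E" and sizes: "\<And>e. e \<in> E \<Longrightarrow> card e = 1 \<or> card e = 2"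
    and conn: "\<And>S. s \<in> S \<Longrightarrow> (\<And>u v. u \<in> S \<Longrightarrow> {u, v} \<in> E \<Longrightarrow> v \<in> S) \<Longrightarrow> \<Union>E \<subseteq> S"
    and st: "stack_colouring {e \<in> E. e \<subseteq> S} c xs" "set xs \<subseteq> S" "S \<subseteq> \<Union>E" "s \<in> S"
      "\<And>u v. u \<in> S - set xs \<Longrightarrow> {u, v} \<in> E \<Longrightarrow> v \<in> S"
  shows "\<exists>c. stack_colouring E c []"
  using st
\<comment> \<open>The factor 2 pays for a push: visiting a vertex lowers the first term by 2 and
  lengthens the stack by 1.\<close>
proof (induction "2 * card (\<Union>E - S) + length xs" arbitrary: S c xs rule: less_induct)
  case less
  let ?H = "{e \<in> E. e \<subseteq> S}"
  interpret stack_colouring ?H c xs by (rule less.prems)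
  have "finite e" if "e \<in> E" for e
    by (rule card_ge_0_finite) (use assms(2)[OF that] in auto)
  then have finE: "finite (\<Union>E)" using assms(1) by blast
  show ?case
  proof (cases "xs = []")
    case True
    then have "\<Union>E \<subseteq> S" using conn[OF less.prems(4)] less.prems(5) by auto
    then have "?H = E" by blast
    then show ?thesis using less.prems(1) True by auto
  next
    case ne: False
    let ?p = "last xs"
    have "set xs = set (butlast xs @ [?p])" using ne by simp
    then have set_xs: "set xs = insert ?p (set (butlast xs))" by simp
    show ?thesis
    proof (cases "\<exists>v. v \<notin> S \<and> {?p, v} \<in> E")
      case False
      have "u \<in> S - set xs \<or> u = ?p" if "u \<in> S - set (butlast xs)" for u
        using that set_xs by blast
      then have "v \<in> S" if "u \<in> S - set (butlast xs)" "{u, v} \<in> E" for u v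
        using that False less.prems(5) by blast
      moreover have "length (butlast xs) < length xs" using ne by simp
      moreover have "set (butlast xs) \<subseteq> S" using less.prems(2) by (meson in_set_butlastD subset_eq)
      ultimately show ?thesis
        using less.hyps[of S "butlast xs" c] popped less.prems(3,4) by simp
    next
      case True
      then obtain v where v: "v \<notin> S" "{?p, v} \<in> E" by blast
      define A where "A = {x \<in> S. {v, x} \<in> E} - {?p}"
      define B where "B \<longleftrightarrow> {v} \<in> E"
      have ps: "?p \<in> S" using less.prems(2) ne by auto
      have "x \<in> set xs" if "x \<in> S" "{v, x} \<in> E" for x
        using less.prems(5)[of x v] that v by (auto simp: insert_commute)
      then have A: "A \<subseteq> set (butlast xs)"
        unfolding A_def using set_xs by blast
      obtain k0 where k0: "degree ?H ?p = 1 \<longrightarrow> (\<forall>e\<in>?H. ?p \<in> e \<longrightarrow> c e \<noteq> k0)"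
        "\<forall>k b. defect k ?p b \<longrightarrow> k = k0" using need_exists[OF ne] by blast
      obtain g where g: "g ?p = k0" "\<forall>a. A = {a} \<longrightarrow> g a \<noteq> k0"
        "A \<noteq> {} \<longrightarrow> (\<forall>a. A \<noteq> {a}) \<longrightarrow> (\<forall>k. \<exists>x\<in>A. g x = k)"
        "\<forall>k x y. lone (colour_class ?H c k) x y \<longrightarrow> x \<in> insert ?p A \<longrightarrow> y \<in> insert ?p A \<longrightarrow>
          g x = k \<or> g y = k"
        using back_colours_exist[OF ne A, of k0] by blast
      interpret X: colouring_extension ?H c xs v A B k0 g
      proof
        show "xs \<noteq> []" by (rule ne)
        show "v \<notin> e" if "e \<in> ?H" for e using that v by blast
        show "A \<subseteq> set (butlast xs)" by (rule A)
        show "c e \<noteq> k0" if "degree ?H ?p = 1" "e \<in> ?H" "?p \<in> e" for e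
          using k0(1) that by blast
        show "k = k0" if "defect k ?p b" for k b using k0(2) that by blast
        show "g ?p = k0" by (rule g(1))
        show "g a \<noteq> k0" if "A = {a}" for a using g(2) that by blast
        show "\<exists>x\<in>A. g x = k" if "A \<noteq> {}" "\<And>a. A \<noteq> {a}" for k using g(3) that by blast
        show "g x = k \<or> g y = k" if "lone (colour_class ?H c k) x y"
          "x \<in> insert ?p A" "y \<in> insert ?p A" for k x y using g(4) that by blast
      qed
      have N: "insert ?p A = {x \<in> S. {v, x} \<in> E}"
        using v ps by (auto simp: A_def insert_commute)
      have "e \<in> X.H'" if e: "e \<in> E" "e \<subseteq> insert v S" for e
      proof (cases "v \<in> e")
        case False
        then have "e \<in> ?H" using e by blast
        then show ?thesis by (rule X.old_in)
      next
        case True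
        show ?thesis
        proof (cases "card e = 1")
          case one: True
          then have "e = {v}" using True by (auto simp: card_1_singleton_iff)
          then show ?thesis using e X.half_in B_def by simp
        next
          case False
          then have "card e = 2" using assms(2)[OF e(1)] by blast
          then obtain x where x: "e = {v, x}" "x \<noteq> v" using True by (auto simp: card_2_iff)
          then have "x \<in> insert ?p A" using e N by auto
          then show ?thesis using x X.new_in by simp
        qed
      qed
      moreover have "e \<in> E \<and> e \<subseteq> insert v S" if h: "e \<in> X.H'" for e
      proof -
        consider "e \<in> ?H" | x where "x \<in> insert ?p A" "e = {v, x}" | "B" "e = {v}"
          using X.H'_v[OF h] X.H'_old[OF h] by blast
        then show ?thesis
        proof cases
          case (2 x)
          then show ?thesis using N by auto
        qed (auto simp: B_def)
      qed
      ultimately have H': "X.H' = {e \<in> E. e \<subseteq> insert v S}" by blast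
      have vE: "v \<in> \<Union>E" using v by blast
      then have c1: "card (\<Union>E - S) = Suc (card (\<Union>E - insert v S))"
        using v finE by (metis Diff_insert card_Suc_Diff1 DiffI finite_Diff)
      have "w \<in> insert v S" if "u \<in> insert v S - set (xs @ [v])" "{u, w} \<in> E" for u w
        using that less.prems(5)[of u w] by auto
      then show ?thesis
        using less.hyps[of "insert v S" "xs @ [v]" X.c'] X.extended less.prems(2-4) c1 vE
        unfolding H' by auto
    qed
  qed
qed

lemma colouring_exists:
  fixes E :: "'a set set"
  assumes "finite E" and sizes: "\<And>e. e \<in> E \<Longrightarrow> card e = 1 \<or> card e = 2" and s: "{s} \<in> E"
    and "\<And>S. s \<in> S \<Longrightarrow> (\<And>u v. u \<in> S \<Longrightarrow> {u, v} \<in> E \<Longrightarrow> v \<in> S) \<Longrightarrow> \<Union>E \<subseteq> S"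
  shows "\<exists>c. stack_colouring E c []"
proof -
  have "e = {s}" if "e \<in> E" "e \<subseteq> {s}" for e using sizes[OF that(1)] that(2) by (auto simp: subset_singleton_iff)
  then have "{e \<in> E. e \<subseteq> {s}} = {{s}}" using s by auto
  then have start: "stack_colouring {e \<in> E. e \<subseteq> {s}} (\<lambda>_. True) [s]"
    by (simp add: stack_colouring_single)
  show ?thesis
    by (rule depth_first_colouring[OF assms(1,2) _ start]) (use assms(4) s in auto)
qed

section \<open>From a nearly locating class to a locating-dominating set\<close>

definition uncovered :: "'a set set \<Rightarrow> 'a \<Rightarrow> bool" where
  "uncovered D y \<longleftrightarrow> (\<forall>d\<in>D. y \<notin> d)"

text \<open>In the applications the uncovered neighbour is a leaf whose edge is in the other class,
  or the root after its half-edge has been removed.\<close>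

definition bare :: "'a set set \<Rightarrow> 'a set set \<Rightarrow> 'a \<Rightarrow> bool" where
  "bare E D x \<longleftrightarrow> (\<exists>y. {x, y} \<in> E \<and> uncovered D y)"

definition square_free :: "'a set set \<Rightarrow> 'a set set \<Rightarrow> bool" where
  "square_free E D \<longleftrightarrow> (\<forall>x y z w. lone D x y \<longrightarrow> lone D z w \<longrightarrow> {x, y} \<inter> {z, w} = {} \<longrightarrow>
     {x, z} \<in> E \<longrightarrow> {y, w} \<notin> E)"

locale edge_graph =
  fixes E :: "'a set set"
  assumes finite_E: "finite E"
    and card_edge: "e \<in> E \<Longrightarrow> card e = 2"

text \<open>Apart from \<open>lone_square\<close> and \<open>cherry_bare\<close>, the clauses after
  \<open>sub\<close> exclude ways in which an edge outside \<open>D\<close> meets no edge of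
  \<open>D\<close>, or two such edges meet the same ones. The other two leave room for a repair: a
  pair of degree-2 vertices whose edge can be exchanged, and a vertex of the cherry without
  uncovered neighbours that can become its centre.\<close>

locale nearly_locating = edge_graph +
  fixes D :: "'a set set"
  assumes sub: "D \<subseteq> E"
    and edge_covered: "{x, y} \<in> E \<Longrightarrow> uncovered D x \<Longrightarrow> \<not> uncovered D y"
    and bare_unique: "{x, y} \<in> E \<Longrightarrow> {x, z} \<in> E \<Longrightarrow> uncovered D y \<Longrightarrow> uncovered D z \<Longrightarrow> y = z"
    and lone_triangle: "lone D x y \<Longrightarrow> {x, z} \<in> E \<Longrightarrow> {y, z} \<notin> E"
    and lone_square: "lone D x y \<Longrightarrow> lone D z w \<Longrightarrow> {x, y} \<inter> {z, w} = {} \<Longrightarrow> {x, z} \<in> E \<Longrightarrow>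
      {y, w} \<in> E \<Longrightarrow> degree E x = 2 \<and> degree E y = 2 \<or> degree E z = 2 \<and> degree E w = 2"
    and lone_bare: "lone D x y \<Longrightarrow> bare E D x \<Longrightarrow> \<not> bare E D y"
    and cherry_bare: "{x, y} \<in> D \<Longrightarrow> {y, z} \<in> D \<Longrightarrow> x \<noteq> z \<Longrightarrow> {x, z} \<in> E \<Longrightarrow> {x, z} \<notin> D \<Longrightarrow>
      (\<And>d. d \<in> D \<Longrightarrow> d \<inter> {x, y, z} \<noteq> {} \<Longrightarrow> d = {x, y} \<or> d = {y, z}) \<Longrightarrow>
      \<not> (bare E D x \<and> bare E D y \<and> bare E D z)"

context edge_graph
begin

lemma edge_neq: "{x, y} \<in> E \<Longrightarrow> x \<noteq> y"
  using card_edge by fastforce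

lemma finite_vertices: "finite (\<Union>E)"
proof -
  have "finite e" if "e \<in> E" for e
    by (rule card_ge_0_finite) (simp add: card_edge[OF that])
  then show ?thesis using finite_E by blast
qed

lemma edge_obtain:
  assumes "e \<in> E" obtains x y where "e = {x, y}" "x \<noteq> y"
  using card_edge[OF assms] by (metis card_2_iff)

end

section \<open>Removing 4-cycles between one-edge components\<close>

context nearly_locating
begin

lemma finite_D: "finite D"
  using finite_subset[OF sub finite_E] .

text \<open>Exchanging \<open>{a, b}\<close> for \<open>{a, g}\<close> merges the two components
  into the path \<open>a\<close>, \<open>g\<close>, \<open>h\<close> and uncovers \<open>b\<close>.
  Degree 2 confines the damage: only \<open>a\<close> and \<open>h\<close> are adjacent to
  \<open>b\<close>; \<open>h\<close> had no uncovered neighbour, and the other neighbour of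
  \<open>a\<close> is the covered vertex \<open>g\<close>. Moreover \<open>a\<close> is not adjacent
  to \<open>h\<close>, so the new path is not a cherry with a chord.\<close>

lemma square_swap:
  assumes ab: "lone D a b" and gh: "lone D g h" and dis: "{a, b} \<inter> {g, h} = {}"
    and ag: "{a, g} \<in> E" and bh: "{b, h} \<in> E"
    and da: "degree E a = 2" and db: "degree E b = 2" and h: "\<not> bare E D h"
  defines "D' \<equiv> insert {a, g} (D - {{a, b}})"
  shows "nearly_locating E D'" and "card D' = card D"
    and "lone D' x y \<Longrightarrow> lone D x y" and "\<not> lone D' a b"
proof -
  have neq: "a \<noteq> b" "g \<noteq> h" "a \<noteq> g" "a \<noteq> h" "b \<noteq> g" "b \<noteq> h" using ab gh dis by (auto simp: lone_def)
  have inD: "{a, b} \<in> D" "{g, h} \<in> D" using ab gh by (auto simp: lone_def)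
  have abE: "{a, b} \<in> E" using inD sub by blast
  have agD: "{a, g} \<notin> D" using lone_eq[OF ab, of "{a, g}"] neq by (auto simp: doubleton_eq_iff)
  have ghD': "{g, h} \<in> D'" "{a, g} \<in> D'" using inD neq by (auto simp: D'_def doubleton_eq_iff)
  have na: "x = b \<or> x = g" if "{a, x} \<in> E" for x
    using degree_2_cases[OF finite_E da abE ag _ _ _ that] neq by (auto simp: doubleton_eq_iff)
  have nb: "x = a \<or> x = h" if "{b, x} \<in> E" for x
    using degree_2_cases[OF finite_E db abE bh _ _ _ that] neq by (auto simp: doubleton_eq_iff)
  have D'D: "d \<in> D" "d \<noteq> {a, b}" if "d \<in> D'" "d \<noteq> {a, g}" for d
    using that by (auto simp: D'_def)
  have DD': "d \<in> D'" if "d \<in> D" "d \<noteq> {a, b}" for d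
    using that by (auto simp: D'_def)
  have unc: "uncovered D' y \<longleftrightarrow> uncovered D y \<or> y = b" for y
  proof
    assume u: "uncovered D' y"
    show "uncovered D y \<or> y = b"
    proof (rule ccontr)
      assume "\<not> ?thesis"
      then obtain d where d: "d \<in> D" "y \<in> d" "y \<noteq> b" by (auto simp: uncovered_def)
      show False
      proof (cases "d = {a, b}")
        case True
        then have "y = a" using d by simp
        then show ?thesis using u ghD' by (auto simp: uncovered_def)
      next
        case False
        then show ?thesis using DD'[OF d(1)] d u by (auto simp: uncovered_def)
      qed
    qed
  next
    assume "uncovered D y \<or> y = b"
    then show "uncovered D' y"
    proof
      assume u: "uncovered D y"
      then have "y \<noteq> a" "y \<noteq> g" using inD by (auto simp: uncovered_def)
      then show ?thesis using u by (auto simp: uncovered_def D'_def)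
    next
      assume "y = b"
      then show ?thesis using neq lone_eq[OF ab] by (auto simp: uncovered_def D'_def)
    qed
  qed
  have bare: "bare E D x" if x: "bare E D' x" "x \<noteq> a" "x \<noteq> h" for x
  proof -
    obtain y where y: "{x, y} \<in> E" "uncovered D' y" using x(1) by (auto simp: bare_def)
    have "y \<noteq> b" using nb[of x] y(1) x(2,3) by (auto simp: insert_commute)
    then show ?thesis using y unc by (auto simp: bare_def)
  qed
  have lone: "lone D x y \<and> {x, y} \<inter> {a, b, g, h} = {}" if l: "lone D' x y" for x y
  proof -
    have xy: "x \<noteq> y" "{x, y} \<in> D'" using l by (auto simp: lone_def)
    have ne: "{x, y} \<noteq> {a, g}"
    proof
      assume eq: "{x, y} = {a, g}"
      then have "g \<in> {x, y}" by blast
      then have "{g, h} = {x, y}" using lone_eq[OF l ghD'(1)] by auto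
      then show False using eq neq by (auto simp: doubleton_eq_iff)
    qed
    then have D: "{x, y} \<in> D" "{x, y} \<noteq> {a, b}" using D'D xy by blast+
    then have "a \<notin> {x, y}" "b \<notin> {x, y}" using lone_eq[OF ab D(1)] by auto
    moreover have gne: "g \<notin> {x, y}"
    proof
      assume "g \<in> {x, y}"
      then have "{a, g} = {x, y}" using lone_eq[OF l ghD'(2)] by auto
      then show False using ne by simp
    qed
    moreover have "h \<notin> {x, y}"
    proof
      assume "h \<in> {x, y}"
      then have "{x, y} = {g, h}" using lone_eq[OF gh D(1)] by auto
      then show False using gne by auto
    qed
    moreover have "lone D x y"
      unfolding lone_def
    proof (intro conjI ballI impI)
      fix d assume d: "d \<in> D" "x \<in> d \<or> y \<in> d"
      then have "d \<noteq> {a, b}" using calculation by auto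
      then show "d = {x, y}" using lone_eq[OF l DD'[OF d(1)]] d(2) by blast
    qed (use xy D in auto)
    ultimately show ?thesis by auto
  qed
  then show "lone D' x y \<Longrightarrow> lone D x y" by blast
  show "\<not> lone D' a b" using lone[of a b] by auto
  show "card D' = card D"
    using agD card_Suc_Diff1[OF finite_D inD(1)] finite_D by (simp add: D'_def)
  show "nearly_locating E D'"
  proof
    show "D' \<subseteq> E" using sub ag by (auto simp: D'_def)
    show "\<not> uncovered D' y" if "{x, y} \<in> E" "uncovered D' x" for x y
    proof
      assume y: "uncovered D' y"
      have "\<not> uncovered D' a" "\<not> uncovered D' h" using ghD' by (auto simp: uncovered_def)
      then have "x \<noteq> b" "y \<noteq> b" using nb[of x] nb[of y] that y by (auto simp: insert_commute)
      then show False using edge_covered[OF that(1)] unc that(2) y by blast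
    qed
    show "y = z" if e: "{x, y} \<in> E" "{x, z} \<in> E" and u: "uncovered D' y" "uncovered D' z" for x y z
    proof -
      have *: "z' = b" if "{x, b} \<in> E" "{x, z'} \<in> E" "uncovered D' z'" for z'
      proof (rule ccontr)
        assume "z' \<noteq> b"
        then have uz: "uncovered D z'" using unc that by blast
        have "x = a \<or> x = h" using nb[of x] that by (simp add: insert_commute)
        then show False
        proof
          assume "x = a"
          then have "z' = g" using na[of z'] that \<open>z' \<noteq> b\<close> by blast
          then show False using uz inD by (auto simp: uncovered_def)
        next
          assume "x = h"
          then show False using h uz that by (auto simp: bare_def)
        qed
      qed
      show ?thesis
      proof (cases "y = b \<or> z = b")
        case True
        then show ?thesis using * e u by blast
      next
        case False
        then show ?thesis using bare_unique[OF e] unc u by blast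
      qed
    qed
    show "{y, z} \<notin> E" if "lone D' x y" "{x, z} \<in> E" for x y z
      using lone_triangle lone that by blast
    show "degree E x = 2 \<and> degree E y = 2 \<or> degree E z = 2 \<and> degree E w = 2"
      if "lone D' x y" "lone D' z w" "{x, y} \<inter> {z, w} = {}" "{x, z} \<in> E" "{y, w} \<in> E" for x y z w
      using lone_square[OF _ _ that(3-5)] lone that(1,2) by blast
    show "\<not> bare E D' y" if "lone D' x y" "bare E D' x" for x y
    proof -
      have "lone D x y" "x \<noteq> a" "x \<noteq> h" "y \<noteq> a" "y \<noteq> h" using lone[OF that(1)] by auto
      then show ?thesis using bare that(2) lone_bare by blast
    qed
    show "\<not> (bare E D' x \<and> bare E D' y \<and> bare E D' z)"
      if xy: "{x, y} \<in> D'" "{y, z} \<in> D'" and xz: "x \<noteq> z" "{x, z} \<in> E" "{x, z} \<notin> D'"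
        and cl: "\<And>d. d \<in> D' \<Longrightarrow> d \<inter> {x, y, z} \<noteq> {} \<Longrightarrow> d = {x, y} \<or> d = {y, z}" for x y z
    proof -
      have cov: "\<not> uncovered D' x" "\<not> uncovered D' y" "\<not> uncovered D' z"
        using xy by (auto simp: uncovered_def)
      then have b: "b \<notin> {x, y, z}" using unc by blast
      have g: "g \<notin> {x, y, z}"
      proof
        assume "g \<in> {x, y, z}"
        then have "{a, g} = {x, y} \<or> {a, g} = {y, z}" "{g, h} = {x, y} \<or> {g, h} = {y, z}"
          using cl[OF ghD'(1)] cl[OF ghD'(2)] by auto
        then have "{x, z} = {a, h}" using neq xz(1) by (auto simp: doubleton_eq_iff)
        then show False using na[of h] xz(2) neq by auto
      qed
      have "a \<notin> {x, y, z}" 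
        using cl[OF ghD'(2)] g by auto
      moreover have "h \<notin> {x, y, z}" using cl[OF ghD'(1)] g by auto
      moreover have "{x, y} \<in> D" "{y, z} \<in> D" using D'D xy g by blast+
      moreover have "{x, z} \<notin> D" using DD' xz(3) b by blast
      moreover have "d = {x, y} \<or> d = {y, z}" if "d \<in> D" "d \<inter> {x, y, z} \<noteq> {}" for d
      proof -
        have "d \<noteq> {a, b}" using that(2) b calculation(1) by auto
        then show ?thesis using cl[OF DD'[OF that(1)] that(2)] by blast
      qed
      ultimately show ?thesis using cherry_bare[of x y z] xz bare[of x] bare[of y] bare[of z] by auto
    qed
  qed
qed

end

lemma (in edge_graph) square_free_exists:
  assumes "nearly_locating E D"
  shows "\<exists>D'. nearly_locating E D' \<and> square_free E D' \<and> card D' \<le> card D"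
  using assms
proof (induction "card {(x, y) \<in> \<Union>E \<times> \<Union>E. lone D x y}" arbitrary: D rule: less_induct)
  case less
  interpret nearly_locating E D by (rule less.prems)
  show ?case
  proof (cases "square_free E D")
    case False
    then obtain x y z w where l: "lone D x y" "lone D z w" "{x, y} \<inter> {z, w} = {}"
      "{x, z} \<in> E" "{y, w} \<in> E" unfolding square_free_def by blast
    have "\<exists>a b g h. lone D a b \<and> lone D g h \<and> {a, b} \<inter> {g, h} = {} \<and> {a, g} \<in> E \<and> {b, h} \<in> E \<and>
      degree E a = 2 \<and> degree E b = 2"
      using lone_square[OF l]
    proof
      assume "degree E x = 2 \<and> degree E y = 2"
      then show ?thesis using l by blast
    next
      assume "degree E z = 2 \<and> degree E w = 2"
      moreover have "{z, w} \<inter> {x, y} = {}" "{z, x} \<in> E" "{w, y} \<in> E"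
        using l by (auto simp: insert_commute)
      ultimately show ?thesis using l(1,2) by blast
    qed
    then obtain a b g h where s: "lone D a b" "lone D g h" "{a, b} \<inter> {g, h} = {}" "{a, g} \<in> E"
      "{b, h} \<in> E" "degree E a = 2" "degree E b = 2" by blast
    \<comment> \<open>By \<open>lone_bare\<close> one of \<open>g\<close> and \<open>h\<close> has
      no uncovered neighbour; reversing both pairs, if necessary, makes it \<open>h\<close>.\<close>
    have "\<exists>a b g h. lone D a b \<and> lone D g h \<and> {a, b} \<inter> {g, h} = {} \<and> {a, g} \<in> E \<and> {b, h} \<in> E \<and>
      degree E a = 2 \<and> degree E b = 2 \<and> \<not> bare E D h"
    proof (cases "bare E D h")
      case True
      then have "\<not> bare E D g" using lone_bare[OF lone_sym[OF s(2)]] by blast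
      moreover have "{b, a} \<inter> {h, g} = {}" using s(3) by auto
      ultimately show ?thesis using s lone_sym[OF s(1)] lone_sym[OF s(2)] by blast
    next
      case False
      then show ?thesis using s by blast
    qed
    then obtain a b g h where s: "lone D a b" "lone D g h" "{a, b} \<inter> {g, h} = {}" "{a, g} \<in> E"
      "{b, h} \<in> E" "degree E a = 2" "degree E b = 2" "\<not> bare E D h" by blast
    define D' where "D' = insert {a, g} (D - {{a, b}})"
    note sw = square_swap[OF s, folded D'_def]
    have "a \<in> \<Union>E" "b \<in> \<Union>E" using s(4,5) by auto
    then have "(a, b) \<in> {(x, y) \<in> \<Union>E \<times> \<Union>E. lone D x y}" using s(1) by simp
    moreover have "(a, b) \<notin> {(x, y) \<in> \<Union>E \<times> \<Union>E. lone D' x y}" using sw(4) by simp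
    moreover have "{(x, y) \<in> \<Union>E \<times> \<Union>E. lone D' x y} \<subseteq> {(x, y) \<in> \<Union>E \<times> \<Union>E. lone D x y}"
      using sw(3) by auto
    ultimately have "{(x, y) \<in> \<Union>E \<times> \<Union>E. lone D' x y} \<subset> {(x, y) \<in> \<Union>E \<times> \<Union>E. lone D x y}" by blast
    moreover have "finite {(x, y) \<in> \<Union>E \<times> \<Union>E. lone D x y}"
      by (rule finite_subset[of _ "\<Union>E \<times> \<Union>E"]) (use finite_vertices in auto)
    ultimately have "card {(x, y) \<in> \<Union>E \<times> \<Union>E. lone D' x y} < card {(x, y) \<in> \<Union>E \<times> \<Union>E. lone D x y}"
      by (rule psubset_card_mono[rotated])
    from less.hyps[OF this sw(1)] show ?thesis using sw(2) by simp
  qed (use less.prems in blast)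
qed

section \<open>Rebuilding components on which two edges conflict\<close>

context edge_graph
begin

text \<open>Rearranging edges inside a component keeps the number of edges, so components that are not yet
  locating are rebuilt greedily: the weight rewards claws, and cherries centred at a vertex
  without uncovered neighbours.\<close>
definition vertex_weight :: "'a set set \<Rightarrow> 'a \<Rightarrow> nat" where
  "vertex_weight D x = (if 3 \<le> degree D x then 3
     else if degree D x = 2 \<and> \<not> bare E D x then 1 else 0)"

definition weight :: "'a set set \<Rightarrow> nat" where
  "weight D = (\<Sum>x\<in>\<Union>E. vertex_weight D x)"

lemma weight_le: "weight D \<le> 3 * card (\<Union>E)"
proof -
  have "weight D \<le> (\<Sum>x\<in>\<Union>E. 3)"
    unfolding weight_def by (intro sum_mono) (simp add: vertex_weight_def)
  then show ?thesis by simp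
qed

definition improves :: "'a set set \<Rightarrow> 'a set set \<Rightarrow> bool" where
  "improves D D' \<longleftrightarrow> nearly_locating E D' \<and> square_free E D' \<and>
    (card D' < card D \<or> card D' = card D \<and> weight D < weight D')"

end

lemma not_uncovered: "d \<in> D \<Longrightarrow> y \<in> d \<Longrightarrow> \<not> uncovered D y"
  by (auto simp: uncovered_def)

text \<open>\<open>Q\<close> is a union of components of both sets, and both cover all of it, so no
  vertex changes between covered and uncovered and \<open>bare\<close> keeps its meaning. Only the
  components of the new set inside \<open>Q\<close> can then violate a clause.\<close>

locale component_swap = nearly_locating +
  fixes D' Q
  assumes sq: "square_free E D"
    and D'E: "D' \<subseteq> E"
    and closed: "d \<in> D \<or> d \<in> D' \<Longrightarrow> d \<inter> Q \<noteq> {} \<Longrightarrow> d \<subseteq> Q"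
    and same: "d \<inter> Q = {} \<Longrightarrow> d \<in> D \<longleftrightarrow> d \<in> D'"
    and cov: "y \<in> Q \<Longrightarrow> \<not> uncovered D y" and cov': "y \<in> Q \<Longrightarrow> \<not> uncovered D' y"
    and no_lone: "lone D' x y \<Longrightarrow> x \<notin> Q"
    and cherry_Q: "{x, y, z} \<subseteq> Q \<Longrightarrow> {x, y} \<in> D' \<Longrightarrow> {y, z} \<in> D' \<Longrightarrow> x \<noteq> y \<Longrightarrow> y \<noteq> z \<Longrightarrow> x \<noteq> z \<Longrightarrow>
      (\<And>d. d \<in> D' \<Longrightarrow> d \<inter> {x, y, z} \<noteq> {} \<Longrightarrow> d = {x, y} \<or> d = {y, z}) \<Longrightarrow>
      \<not> (bare E D x \<and> bare E D y \<and> bare E D z)"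
begin

lemma same_out: "x \<notin> Q \<Longrightarrow> x \<in> d \<Longrightarrow> d \<in> D \<longleftrightarrow> d \<in> D'"
  using closed[of d] same[of d] by blast

lemma uncovered_same: "uncovered D' y \<longleftrightarrow> uncovered D y"
proof (cases "y \<in> Q")
  case True
  then show ?thesis using cov cov' by blast
next
  case False
  then show ?thesis using same_out[OF False] by (auto simp: uncovered_def)
qed

lemma bare_same: "bare E D' x \<longleftrightarrow> bare E D x"
  by (simp add: bare_def uncovered_same)

lemma lone_same:
  assumes l: "lone D' x y" shows "lone D x y"
proof -
  have Q: "x \<notin> Q" "y \<notin> Q" using no_lone[OF l] no_lone[OF lone_sym[OF l]] by auto
  have "{x, y} \<in> D" using same_out[OF Q(1), of "{x, y}"] l by (simp add: lone_def)
  moreover have "d = {x, y}" if "d \<in> D" "x \<in> d \<or> y \<in> d" for d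
    using lone_eq[OF l, of d] same_out[OF Q(1), of d] same_out[OF Q(2), of d] that by blast
  moreover have "x \<noteq> y" using l by (simp add: lone_def)
  ultimately show ?thesis unfolding lone_def by blast
qed

lemma degree_out: "x \<notin> Q \<Longrightarrow> degree D' x = degree D x"
  unfolding degree_def using same_out by metis

lemma nearly_locating': "nearly_locating E D'"
proof
  show "D' \<subseteq> E" by (rule D'E)
  show "\<not> uncovered D' y" if "{x, y} \<in> E" "uncovered D' x" for x y
    using edge_covered[OF that(1)] that(2) uncovered_same by blast
  show "y = z" if "{x, y} \<in> E" "{x, z} \<in> E" "uncovered D' y" "uncovered D' z" for x y z
    using bare_unique[OF that(1,2)] that(3,4) uncovered_same by blast
  show "{y, z} \<notin> E" if "lone D' x y" "{x, z} \<in> E" for x y z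
    using lone_triangle lone_same that by blast
  show "degree E x = 2 \<and> degree E y = 2 \<or> degree E z = 2 \<and> degree E w = 2"
    if "lone D' x y" "lone D' z w" "{x, y} \<inter> {z, w} = {}" "{x, z} \<in> E" "{y, w} \<in> E" for x y z w
    using lone_square[OF _ _ that(3-5)] lone_same that(1,2) by blast
  show "\<not> bare E D' y" if "lone D' x y" "bare E D' x" for x y
    using lone_bare[OF lone_same[OF that(1)]] that(2) bare_same by blast
  show "\<not> (bare E D' x \<and> bare E D' y \<and> bare E D' z)"
    if xy: "{x, y} \<in> D'" "{y, z} \<in> D'" and xz: "x \<noteq> z" "{x, z} \<in> E" "{x, z} \<notin> D'"
      and cl: "\<And>d. d \<in> D' \<Longrightarrow> d \<inter> {x, y, z} \<noteq> {} \<Longrightarrow> d = {x, y} \<or> d = {y, z}" for x y z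
  proof -
    have n: "x \<noteq> y" "y \<noteq> z" using xy D'E edge_neq by blast+
    show ?thesis
    proof (cases "y \<in> Q")
      case True
      then have "{x, y, z} \<subseteq> Q" using closed[of "{x, y}"] closed[of "{y, z}"] xy by auto
      then show ?thesis using cherry_Q[OF _ xy n xz(1) cl] bare_same by blast
    next
      case False
      then have Q: "x \<notin> Q" "z \<notin> Q" using closed[of "{x, y}"] closed[of "{y, z}"] xy by auto
      have "{x, y} \<in> D" "{y, z} \<in> D" "{x, z} \<notin> D" 
        using xy xz(3) same_out[OF Q(1)] same_out[OF Q(2)] by auto
      moreover have "d = {x, y} \<or> d = {y, z}" if "d \<in> D" "d \<inter> {x, y, z} \<noteq> {}" for d
        using cl[of d] that same_out[OF Q(1)] same_out[OF Q(2)] same_out[OF False] by auto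
      ultimately show ?thesis using cherry_bare[of x y z] xz bare_same by blast
    qed
  qed
qed

lemma square_free': "square_free E D'"
  unfolding square_free_def
proof (intro allI impI)
  fix x y z w
  assume a: "lone D' x y" "lone D' z w" "{x, y} \<inter> {z, w} = {}" "{x, z} \<in> E"
  show "{y, w} \<notin> E"
    using sq[unfolded square_free_def, rule_format, OF lone_same[OF a(1)] lone_same[OF a(2)] a(3,4)] .
qed

lemma Q_vertices: "Q \<subseteq> \<Union>E"
  using cov' D'E unfolding uncovered_def by blast

lemma weight_less:
  assumes "(\<Sum>x\<in>Q. vertex_weight D x) < (\<Sum>x\<in>Q. vertex_weight D' x)"
  shows "weight D < weight D'"
proof -
  have "vertex_weight D' x = vertex_weight D x" if "x \<in> \<Union>E - Q" for x
    using that by (simp add: vertex_weight_def degree_out bare_same)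
  then have "(\<Sum>x\<in>\<Union>E - Q. vertex_weight D' x) = (\<Sum>x\<in>\<Union>E - Q. vertex_weight D x)"
    by (rule sum.cong[OF refl])
  then show ?thesis
    using sum.subset_diff[OF Q_vertices finite_vertices, of "vertex_weight D"]
      sum.subset_diff[OF Q_vertices finite_vertices, of "vertex_weight D'"] assms
    by (simp add: weight_def)
qed

end

text \<open>Two disjoint edges outside \<open>D\<close> meet the same edges of \<open>D\<close>
  precisely when each edge of \<open>D\<close> at their ends runs from one to the other. There are
  at most four such crossing edges, and the lemmas below go through the subgraphs of the 4-cycle
  that they form.\<close>

locale conflict = nearly_locating +
  fixes u v x y
  assumes sqf: "square_free E D"
    and uv: "{u, v} \<in> E" "{u, v} \<notin> D" and xy: "{x, y} \<in> E" "{x, y} \<notin> D"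
    and disjoint: "{u, v} \<inter> {x, y} = {}"
    and cross: "d \<in> D \<Longrightarrow> d \<inter> {u, v, x, y} \<noteq> {} \<Longrightarrow> d = {u, x} \<or> d = {u, y} \<or> d = {v, x} \<or> d = {v, y}"
begin

lemma neq: "u \<noteq> v" "x \<noteq> y" "u \<noteq> x" "u \<noteq> y" "v \<noteq> x" "v \<noteq> y"
  using edge_neq uv xy disjoint by auto

lemma swap_uv: "conflict E D v u x y"
proof
  show "{v, u} \<inter> {x, y} = {}" using disjoint by auto
  show "d = {v, x} \<or> d = {v, y} \<or> d = {u, x} \<or> d = {u, y}"
    if "d \<in> D" "d \<inter> {v, u, x, y} \<noteq> {}" for d using cross[OF that(1)] that(2) by auto
qed (use sqf uv xy in \<open>simp_all add: insert_commute\<close>)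

lemma swap_xy: "conflict E D u v y x"
proof
  show "{u, v} \<inter> {y, x} = {}" using disjoint by auto
  show "d = {u, y} \<or> d = {u, x} \<or> d = {v, y} \<or> d = {v, x}"
    if "d \<in> D" "d \<inter> {u, v, y, x} \<noteq> {}" for d using cross[OF that(1)] that(2) by auto
qed (use sqf uv xy in \<open>simp_all add: insert_commute\<close>)

lemma swap_pairs: "conflict E D x y u v"
proof
  show "{x, y} \<inter> {u, v} = {}" using disjoint by auto
  show "d = {x, u} \<or> d = {x, v} \<or> d = {y, u} \<or> d = {y, v}"
    if "d \<in> D" "d \<inter> {x, y, u, v} \<noteq> {}" for d
    using cross[OF that(1)] that(2) by (auto simp: insert_commute)
qed (use sqf uv xy in simp_all)

text \<open>With a single crossing edge \<open>v\<close> and \<open>y\<close> are uncovered, so both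
  ends of a one-edge component would be \<open>bare\<close>.\<close>

lemma not_one:
  assumes "{u, x} \<in> D" "{u, y} \<notin> D" "{v, x} \<notin> D" shows "{v, y} \<in> D"
proof (rule ccontr)
  assume n: "{v, y} \<notin> D"
  have only: "d = {u, x}" if "d \<in> D" "d \<inter> {u, v, x, y} \<noteq> {}" for d
    using cross[OF that] that(1) assms n by auto
  have "uncovered D v" "uncovered D y"
    unfolding uncovered_def using only neq by fastforce+
  then have "bare E D u" "bare E D x" using uv xy by (auto simp: bare_def)
  moreover have "lone D u x" unfolding lone_def using only neq assms by blast
  ultimately show False using lone_bare by blast
qed

text \<open>Two disjoint crossing edges alone would be one-edge components facing each other in a
  4-cycle.\<close>

lemma not_matching:
  assumes "{u, x} \<in> D" "{v, y} \<in> D" "{u, y} \<notin> D" shows "{v, x} \<in> D"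
proof (rule ccontr)
  assume n: "{v, x} \<notin> D"
  have only: "d = {u, x} \<or> d = {v, y}" if "d \<in> D" "d \<inter> {u, v, x, y} \<noteq> {}" for d
    using cross[OF that] that(1) assms n by auto
  have "d = {u, x}" if "d \<in> D" "u \<in> d \<or> x \<in> d" for d
    using only[OF that(1)] that(2) neq by auto
  then have "lone D u x" unfolding lone_def using neq assms by blast
  moreover have "d = {v, y}" if "d \<in> D" "v \<in> d \<or> y \<in> d" for d
    using only[OF that(1)] that(2) neq by auto
  then have "lone D v y" unfolding lone_def using neq assms by blast
  moreover have "{u, x} \<inter> {v, y} = {}" using neq by auto
  ultimately show False using sqf uv(1) xy(1) unfolding square_free_def by blast
qed

text \<open>Three or four crossing edges cover all four vertices, and so does the claw at
  \<open>x\<close> that uses the conflicting edge \<open>{x, y}\<close>. A claw is neither a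
  one-edge nor a two-edge component, so it satisfies the clauses trivially. It saves an edge against
  the 4-cycle and gains weight against the path with three edges.\<close>

lemma claw_improves:
  assumes ux: "{u, x} \<in> D" and vx: "{v, x} \<in> D" and vy: "{v, y} \<in> D"
  shows "\<exists>D'. improves D D'"
proof -
  define K where "K = {{u, x}, {u, y}, {v, x}, {v, y}}"
  define T where "T = {{x, u}, {x, v}, {x, y}}"
  define D' where "D' = (D - K) \<union> T"
  let ?Q = "{u, v, x, y}"
  have K: "d \<in> K" if "d \<in> D" "d \<inter> ?Q \<noteq> {}" for d using cross[OF that] by (auto simp: K_def)
  have KQ: "d \<subseteq> ?Q" "d \<inter> ?Q \<noteq> {}" if "d \<in> K" for d using that by (auto simp: K_def)
  have TQ: "d \<subseteq> ?Q" "x \<in> d" if "d \<in> T" for d using that by (auto simp: T_def)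
  have D'Q: "d \<in> T" if "d \<in> D'" "d \<inter> ?Q \<noteq> {}" for d
    using that K by (auto simp: D'_def)
  have T: "{x, u} \<in> D'" "{x, v} \<in> D'" "{x, y} \<in> D'" by (auto simp: D'_def T_def)
  have Tx: "\<exists>d\<in>D'. x \<in> d \<and> d \<noteq> e \<and> d \<noteq> f" for e f
  proof -
    have "{x, u} \<noteq> {x, v}" "{x, u} \<noteq> {x, y}" "{x, v} \<noteq> {x, y}" using neq by (auto simp: doubleton_eq_iff)
    then show ?thesis using T by (metis insertI1)
  qed
  interpret S: component_swap E D D' ?Q
  proof
    show "square_free E D" by (rule sqf)
    show "D' \<subseteq> E" using sub ux vx xy by (auto simp: D'_def T_def insert_commute)
    show "d \<subseteq> ?Q" if "d \<in> D \<or> d \<in> D'" "d \<inter> ?Q \<noteq> {}" for d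
      using that K KQ(1) D'Q TQ(1) by blast
    show "d \<in> D \<longleftrightarrow> d \<in> D'" if "d \<inter> ?Q = {}" for d
    proof -
      have "d \<notin> K" using KQ(2) that by blast
      moreover have "d \<notin> T" using TQ(2) that by blast
      ultimately show ?thesis by (simp add: D'_def)
    qed
    show "\<not> uncovered D z" if "z \<in> ?Q" for z
      using that not_uncovered[OF ux] not_uncovered[OF vy] by auto
    show "\<not> uncovered D' z" if "z \<in> ?Q" for z
      using that not_uncovered[OF T(1)] not_uncovered[OF T(2)] not_uncovered[OF T(3)] by auto
    show "z \<notin> ?Q" if l: "lone D' z w" for z w
    proof
      assume "z \<in> ?Q"
      then have "{z, w} \<in> T" using D'Q[of "{z, w}"] l by (auto simp: lone_def)
      then have "x \<in> {z, w}" using TQ(2) by blast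
      then have "d = {z, w}" if "d \<in> D'" "x \<in> d" for d using lone_eq[OF l that(1)] that(2) by auto
      then show False using Tx by metis
    qed
    show "\<not> (bare E D a \<and> bare E D b \<and> bare E D c)"
      if "{a, b, c} \<subseteq> ?Q" "{a, b} \<in> D'" "{b, c} \<in> D'" "a \<noteq> b" "b \<noteq> c" "a \<noteq> c"
        "\<And>d. d \<in> D' \<Longrightarrow> d \<inter> {a, b, c} \<noteq> {} \<Longrightarrow> d = {a, b} \<or> d = {b, c}" for a b c
    proof -
      have "{a, b} \<in> T" using D'Q that(1,2) by blast
      then have "x \<in> {a, b, c}" using TQ(2) by blast
      then have "d = {a, b} \<or> d = {b, c}" if "d \<in> D'" "x \<in> d" for d
        using that \<open>\<And>d. d \<in> D' \<Longrightarrow> d \<inter> {a, b, c} \<noteq> {} \<Longrightarrow> d = {a, b} \<or> d = {b, c}\<close> by blast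
      then show ?thesis using Tx by metis
    qed
  qed
  have T3: "card T = 3" using neq by (auto simp: T_def card_insert_if doubleton_eq_iff)
  have "(D - K) \<inter> T = {}"
    using xy by (auto simp: T_def K_def insert_commute)
  then have cD': "card D' = card (D - K) + 3"
    unfolding D'_def using T3 finite_D by (subst card_Un_disjoint) (auto simp: T_def)
  have "D = (D - K) \<union> (D \<inter> K)" by blast
  then have "card D = card ((D - K) \<union> (D \<inter> K))" by simp
  also have "\<dots> = card (D - K) + card (D \<inter> K)"
    by (rule card_Un_disjoint) (use finite_D in auto)
  finally have cD: "card D = card (D - K) + card (D \<inter> K)" .
  show ?thesis
  proof (cases "{u, y} \<in> D")
    case True
    then have "D \<inter> K = K" using ux vx vy by (auto simp: K_def)
    moreover have "card K = 4" using neq by (auto simp: K_def card_insert_if doubleton_eq_iff)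
    ultimately show ?thesis
      using S.nearly_locating' S.square_free' cD cD' unfolding improves_def by auto
  next
    case False
    then have "D \<inter> K = {{u, x}, {v, x}, {v, y}}" using ux vx vy by (auto simp: K_def)
    moreover have "card {{u, x}, {v, x}, {v, y}} = 3"
      using neq by (auto simp: card_insert_if doubleton_eq_iff)
    ultimately have c: "card D' = card D" using cD cD' by simp
    have d: "{d \<in> D. u \<in> d} = {{u, x}}" "{d \<in> D. v \<in> d} = {{v, x}, {v, y}}"
      "{d \<in> D. x \<in> d} = {{u, x}, {v, x}}" "{d \<in> D. y \<in> d} = {{v, y}}"
      using cross ux vx vy False neq by blast+
    have "degree D u = 1" "degree D v \<le> 2" "degree D x \<le> 2" "degree D y = 1"
      unfolding degree_def d by (auto simp: card_insert_if)
    then have "vertex_weight D u = 0" "vertex_weight D v \<le> 1" "vertex_weight D x \<le> 1"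
      "vertex_weight D y = 0" by (auto simp: vertex_weight_def)
    \<comment> \<open>The path has two inner vertices of weight at most 1 each. This is why the
      centre of a claw is given weight 3.\<close>
    then have "(\<Sum>z\<in>?Q. vertex_weight D z) \<le> 2" using neq by simp
    moreover have "3 \<le> degree D' x"
    proof -
      have "card T \<le> card {d \<in> D'. x \<in> d}"
        using finite_D TQ(2) by (intro card_mono) (auto simp: D'_def T_def)
      then show ?thesis using T3 by (simp add: degree_def)
    qed
    then have "3 \<le> (\<Sum>z\<in>?Q. vertex_weight D' z)" using neq by (simp add: vertex_weight_def)
    ultimately have "weight D < weight D'" by (intro S.weight_less) linarith
    then show ?thesis
      using S.nearly_locating' S.square_free' c unfolding improves_def by blast
  qed
qed

text \<open>The conflict arises because the centre \<open>x\<close> has the uncovered neighbour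
  \<open>y\<close>. Moving the centre to \<open>u\<close>, which has no such neighbour, keeps the
  vertex set and raises the weight of the component from 0 to 1.\<close>

lemma cherry_improves:
  assumes ux: "{u, x} \<in> D" and vx: "{v, x} \<in> D" and n: "{u, y} \<notin> D" "{v, y} \<notin> D"
    and u: "\<not> bare E D u"
  shows "\<exists>D'. improves D D'"
proof -
  define D' where "D' = insert {u, v} (D - {{v, x}})"
  let ?Q = "{u, x, v}"
  have only: "d = {u, x} \<or> d = {v, x}" if "d \<in> D" "d \<inter> {u, v, x, y} \<noteq> {}" for d
    using cross[OF that] that(1) n by auto
  have uy: "uncovered D y"
    unfolding uncovered_def using only neq by fastforce
  then have bx: "bare E D x" using xy by (auto simp: bare_def)
  have D'Q: "d = {u, x} \<or> d = {u, v}" if "d \<in> D'" "d \<inter> ?Q \<noteq> {}" for d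
    using that only[of d] by (auto simp: D'_def)
  have ne: "{u, x} \<noteq> {v, x}" "{u, x} \<noteq> {u, v}" using neq by (auto simp: doubleton_eq_iff)
  have T: "{u, x} \<in> D'" "{u, v} \<in> D'" using ux ne by (auto simp: D'_def)
  interpret S: component_swap E D D' ?Q
  proof
    show "square_free E D" by (rule sqf)
    show "D' \<subseteq> E" using sub uv by (auto simp: D'_def)
    show "d \<subseteq> ?Q" if "d \<in> D \<or> d \<in> D'" "d \<inter> ?Q \<noteq> {}" for d
      using that only[of d] D'Q[of d] by auto
    show "d \<in> D \<longleftrightarrow> d \<in> D'" if "d \<inter> ?Q = {}" for d
      using that by (auto simp: D'_def)
    show "\<not> uncovered D z" if "z \<in> ?Q" for z
      using that not_uncovered[OF ux] not_uncovered[OF vx] by auto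
    show "\<not> uncovered D' z" if "z \<in> ?Q" for z
      using that not_uncovered[OF T(1)] not_uncovered[OF T(2)] by auto
    show "z \<notin> ?Q" if l: "lone D' z w" for z w
    proof
      assume "z \<in> ?Q"
      then have "{z, w} = {u, x} \<or> {z, w} = {u, v}" using D'Q[of "{z, w}"] l by (auto simp: lone_def)
      then have "u \<in> {z, w}" by auto
      then have "{u, x} = {z, w}" "{u, v} = {z, w}" using lone_eq[OF l T(1)] lone_eq[OF l T(2)] by auto
      then show False using ne by simp
    qed
    show "\<not> (bare E D a \<and> bare E D b \<and> bare E D c)"
      if "{a, b, c} \<subseteq> ?Q" "{a, b} \<in> D'" "{b, c} \<in> D'" "a \<noteq> b" "b \<noteq> c" "a \<noteq> c"
        "\<And>d. d \<in> D' \<Longrightarrow> d \<inter> {a, b, c} \<noteq> {} \<Longrightarrow> d = {a, b} \<or> d = {b, c}" for a b c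
    proof -
      have "card {a, b, c} = card ?Q" using that(4-6) neq by simp
      then have "{a, b, c} = ?Q" using that(1) by (intro card_subset_eq) auto
      then show ?thesis using u by auto
    qed
  qed
  have c: "card D' = card D"
    using uv vx card_Suc_Diff1[OF finite_D vx] finite_D by (simp add: D'_def)
  have d: "{d \<in> D. u \<in> d} = {{u, x}}" "{d \<in> D. v \<in> d} = {{v, x}}"
    using only ux vx neq by blast+
  have d': "{d \<in> D. x \<in> d} = {{u, x}, {v, x}}" using only ux vx neq by blast
  have "degree D u = 1" "degree D v = 1" unfolding degree_def d by simp_all
  moreover have "degree D x = 2" using ne unfolding degree_def d' by simp
  ultimately have "(\<Sum>z\<in>?Q. vertex_weight D z) = 0" using bx by (simp add: vertex_weight_def)
  moreover have "{d \<in> D'. u \<in> d} = {{u, x}, {u, v}}" using D'Q T by blast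
  then have "degree D' u = 2" using ne by (simp add: degree_def)
  then have "vertex_weight D' u = 1" using u S.bare_same by (simp add: vertex_weight_def)
  then have "1 \<le> (\<Sum>z\<in>?Q. vertex_weight D' z)" using neq by simp
  ultimately have "weight D < weight D'" by (intro S.weight_less) linarith
  then show ?thesis
    using S.nearly_locating' S.square_free' c unfolding improves_def by blast
qed

lemma two_improves:
  assumes ux: "{u, x} \<in> D" and vx: "{v, x} \<in> D" and n: "{u, y} \<notin> D" "{v, y} \<notin> D"
  shows "\<exists>D'. improves D D'"
proof -
  have only: "d = {u, x} \<or> d = {v, x}" if "d \<in> D" "d \<inter> {u, v, x, y} \<noteq> {}" for d
    using cross[OF that] that(1) n by auto
  have "uncovered D y" unfolding uncovered_def using only neq by fastforce
  then have bx: "bare E D x" using xy by (auto simp: bare_def)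
  have "\<not> (bare E D u \<and> bare E D x \<and> bare E D v)"
  proof (rule cherry_bare)
    show "{u, x} \<in> D" "{x, v} \<in> D" using ux vx by (simp_all add: insert_commute)
    show "u \<noteq> v" "{u, v} \<in> E" "{u, v} \<notin> D" using neq uv by auto
    show "d = {u, x} \<or> d = {x, v}" if "d \<in> D" "d \<inter> {u, x, v} \<noteq> {}" for d
      using only[OF that(1)] that(2) by (auto simp: insert_commute)
  qed
  then consider "\<not> bare E D u" | "\<not> bare E D v" using bx by blast
  then show ?thesis
  proof cases
    case 1
    then show ?thesis using cherry_improves assms by blast
  next
    case 2
    then show ?thesis using conflict.cherry_improves[OF swap_uv] assms by blast
  qed
qed

text \<open>Each lemma above treats one representative. The interpretations supply its images under
  exchanging the ends of either edge and the two edges themselves; what remains is a propositional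
  case analysis on which of the four crossing edges are in \<open>D\<close>.\<close>

lemma conflict_improves: "\<exists>D'. improves D D'"
proof -
  have c: "{x, u} = {u, x}" "{y, u} = {u, y}" "{x, v} = {v, x}" "{y, v} = {v, y}" by auto
  interpret A: conflict E D v u x y by (rule swap_uv)
  interpret B: conflict E D u v y x by (rule swap_xy)
  interpret C: conflict E D v u y x by (rule A.swap_xy)
  interpret A': conflict E D x y u v by (rule swap_pairs)
  interpret B': conflict E D x y v u by (rule A.swap_pairs)
  interpret C': conflict E D y x u v by (rule B.swap_pairs)
  interpret D': conflict E D y x v u by (rule C.swap_pairs)
  have some: "{u, x} \<in> D \<or> {u, y} \<in> D \<or> {v, x} \<in> D \<or> {v, y} \<in> D"
  proof (rule ccontr)
    assume n: "\<not> ?thesis"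
    then have "uncovered D u" "uncovered D v"
      unfolding uncovered_def using cross by blast+
    then show False using edge_covered uv by blast
  qed
  show ?thesis
    using some not_one not_matching claw_improves two_improves
      A.not_one A.not_matching A.claw_improves
      B.not_one B.not_matching B.claw_improves B.two_improves
      C.not_one C.not_matching C.claw_improves
      A'.two_improves C'.two_improves B'.two_improves D'.two_improves
    unfolding c by argo
qed

end

section \<open>From conflicts to a locating-dominating set\<close>

context edge_graph
begin

lemma improvable:
  assumes "nearly_locating E D" "square_free E D" and not: "\<not> edge_locating_dominating E D"
  shows "\<exists>D'. improves D D'"
proof -
  interpret nearly_locating E D by (rule assms(1))
  have dom: "\<exists>d\<in>D. e \<inter> d \<noteq> {}" if e: "e \<in> E - D" for e
  proof (rule ccontr)
    assume n: "\<not> ?thesis"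
    obtain a b where ab: "e = {a, b}" "a \<noteq> b" using e edge_obtain by blast
    then have "uncovered D a" "uncovered D b" using n by (auto simp: uncovered_def)
    then show False using edge_covered e ab by blast
  qed
  have nb: "edge_nbhd E e \<inter> D = {d \<in> D. d \<inter> e \<noteq> {}}" if "e \<notin> D" for e
    using that sub by (auto simp: edge_nbhd_def)
  have "\<exists>e\<in>E - D. \<exists>f\<in>E - D. e \<noteq> f \<and> edge_nbhd E e \<inter> D = edge_nbhd E f \<inter> D"
  proof (rule ccontr)
    assume "\<not> ?thesis"
    then have "\<forall>e\<in>E - D. \<forall>f\<in>E - D. e \<noteq> f \<longrightarrow> edge_nbhd E e \<inter> D \<noteq> edge_nbhd E f \<inter> D" by blast
    moreover have "\<forall>e\<in>E - D. \<exists>d\<in>D. e \<inter> d \<noteq> {}" using dom by blast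
    ultimately show False using not sub unfolding edge_locating_dominating_def by simp
  qed
  then obtain e f where ef: "e \<in> E" "e \<notin> D" "f \<in> E" "f \<notin> D" "e \<noteq> f"
    and nbeq: "edge_nbhd E e \<inter> D = edge_nbhd E f \<inter> D" by blast
  have eq: "{d \<in> D. d \<inter> e \<noteq> {}} = {d \<in> D. d \<inter> f \<noteq> {}}"
    using nbeq nb[OF ef(2)] nb[OF ef(4)] by simp
  have eq': "d \<inter> e \<noteq> {} \<longleftrightarrow> d \<inter> f \<noteq> {}" if "d \<in> D" for d using eq that by blast
  obtain u v where e: "e = {u, v}" "u \<noteq> v" using ef edge_obtain by blast
  obtain x y where f: "f = {x, y}" "x \<noteq> y" using ef edge_obtain by blast
  \<comment> \<open>An edge of \<open>D\<close> at \<open>b\<close> or \<open>b'\<close> can only be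
    \<open>{b, b'}\<close>: if it avoids \<open>a\<close> it has to meet both edges, and through
    \<open>a\<close> it would be one of them. So \<open>b\<close> and \<open>b'\<close> either form
    a one-edge component in a triangle or are both uncovered neighbours of \<open>a\<close>.\<close>
  have no_share: False if s: "e = {a, b}" "f = {a, b'}" "b \<noteq> b'" for a b b'
  proof -
    have at: "d = {b, b'}" if d: "d \<in> D" "b \<in> d \<or> b' \<in> d" "a \<notin> d" for d
    proof -
      have "d \<inter> e \<noteq> {}" "d \<inter> f \<noteq> {}" using d s eq'[OF d(1)] by auto
      then have "b \<in> d" "b' \<in> d" using s d(3) by auto
      moreover have "card d = 2" using d(1) sub card_edge by blast
      ultimately show ?thesis using s(3) by (auto simp: card_2_iff)
    qed
    have na: "a \<notin> d" if "d \<in> D" "b \<in> d \<or> b' \<in> d" for d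
    proof
      assume "a \<in> d"
      have "card d = 2" using that(1) sub card_edge by blast
      then have "d = e \<or> d = f" using that(2) \<open>a \<in> d\<close> s e f by (auto simp: card_2_iff doubleton_eq_iff)
      then show False using ef that(1) by blast
    qed
    show False
    proof (cases "{b, b'} \<in> D")
      case True
      then have "lone D b b'" unfolding lone_def using at na s(3) by blast
      moreover have "{b, a} \<in> E" "{b', a} \<in> E" using ef s by (auto simp: insert_commute)
      ultimately show False using lone_triangle by blast
    next
      case False
      then have "uncovered D b" "uncovered D b'" unfolding uncovered_def using at na by blast+
      then show False using bare_unique ef s by blast
    qed
  qed
  have disj: "{u, v} \<inter> {x, y} = {}"
  proof (rule ccontr)
    assume "\<not> ?thesis"
    then consider "u = x" | "u = y" | "v = x" | "v = y" by auto
    then show False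
    proof cases
      case 1
      then show False using no_share[of u v y] e f ef(5) by auto
    next
      case 2
      then show False using no_share[of u v x] e f ef(5) by (auto simp: insert_commute)
    next
      case 3
      then show False using no_share[of v u y] e f ef(5) by (auto simp: insert_commute)
    next
      case 4
      then show False using no_share[of v u x] e f ef(5) by (auto simp: insert_commute)
    qed
  qed
  have "conflict E D u v x y"
  proof
    show "square_free E D" by (rule assms(2))
    show "{u, v} \<in> E" "{u, v} \<notin> D" "{x, y} \<in> E" "{x, y} \<notin> D" using ef e f by auto
    show "{u, v} \<inter> {x, y} = {}" by (rule disj)
    show "d = {u, x} \<or> d = {u, y} \<or> d = {v, x} \<or> d = {v, y}"
      if d: "d \<in> D" "d \<inter> {u, v, x, y} \<noteq> {}" for d
    proof -
      have "d \<inter> {u, v} \<noteq> {}" "d \<inter> {x, y} \<noteq> {}" using d eq'[OF d(1)] e f by auto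
      then obtain a b where ab: "a \<in> d" "a \<in> {u, v}" "b \<in> d" "b \<in> {x, y}" by blast
      then have "a \<noteq> b" using disj by blast
      moreover have "card d = 2" using d(1) sub card_edge by blast
      ultimately have "d = {a, b}" using ab by (auto simp: card_2_iff)
      then show ?thesis using ab by auto
    qed
  qed
  then show ?thesis by (rule conflict.conflict_improves)
qed

lemma locating_dominating_exists:
  assumes "nearly_locating E D"
  shows "\<exists>D'. edge_locating_dominating E D' \<and> card D' \<le> card D"
proof -
  let ?M = "Suc (3 * card (\<Union>E))"
  have main: "\<exists>D'. edge_locating_dominating E D' \<and> card D' \<le> card D"
    if "nearly_locating E D" "square_free E D" for D
    using that
  \<comment> \<open>This packs the lexicographic order on cardinality and missing weight into one
    number; the factor \<open>?M\<close> exceeds every possible missing weight.\<close>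
  proof (induction "card D * ?M + (3 * card (\<Union>E) - weight D)" arbitrary: D rule: less_induct)
    case less
    show ?case
    proof (cases "edge_locating_dominating E D")
      case False
      then obtain D' where D': "improves D D'" using improvable less.prems by blast
      then consider "card D' < card D" | "card D' = card D" "weight D < weight D'"
        unfolding improves_def by blast
      then have "card D' * ?M + (3 * card (\<Union>E) - weight D') < card D * ?M + (3 * card (\<Union>E) - weight D)"
      proof cases
        case 1
        then have "Suc (card D') * ?M \<le> card D * ?M" by (intro mult_le_mono1) simp
        then show ?thesis by simp
      next
        case 2
        then show ?thesis using weight_le[of D'] by simp
      qed
      moreover have "card D' \<le> card D" "nearly_locating E D'" "square_free E D'"
        using D' unfolding improves_def by auto
      ultimately show ?thesis using less.hyps[of D'] by (meson order_trans)
    qed blast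
  qed
  show ?thesis using square_free_exists[OF assms] main by (meson order_trans)
qed

end

section \<open>Edge-twin-free graphs\<close>

lemma (in edge_graph) closed_edge_nbhd_eq: "e \<in> E \<Longrightarrow> closed_edge_nbhd E e = {d \<in> E. d \<inter> e \<noteq> {}}"
  using card_edge by (fastforce simp: closed_edge_nbhd_def edge_nbhd_def)

locale twin_free_graph = edge_graph +
  assumes twin_free: "edge_twin_free E"
    and no_isolated: "\<nexists>e. isolated_edge E e"
begin

lemma degree_ge1: "{x, y} \<in> E \<Longrightarrow> 1 \<le> degree E x"
  using degree_pos[OF finite_E] by blast

lemma two_edges_degree: "{x, y} \<in> E \<Longrightarrow> {x, z} \<in> E \<Longrightarrow> y \<noteq> z \<Longrightarrow> 2 \<le> degree E x"
  by (rule degree_ge2[OF finite_E, of "{x, y}" "{x, z}"]) (auto simp: doubleton_eq_iff)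

lemma leaf_edge: "degree E y = 1 \<Longrightarrow> {x, y} \<in> E \<Longrightarrow> d \<in> E \<Longrightarrow> y \<in> d \<Longrightarrow> d = {x, y}"
  using degree_1_unique[of E y] by blast

lemma not_both_leaves: "{x, y} \<in> E \<Longrightarrow> degree E x = 1 \<Longrightarrow> degree E y \<noteq> 1"
  using no_isolated unfolding isolated_edge_def by blast

lemma support_degree: "{x, y} \<in> E \<Longrightarrow> degree E y = 1 \<Longrightarrow> 2 \<le> degree E x"
  using not_both_leaves[of x y] degree_ge1[of x y] by force

text \<open>Both edges would meet exactly the edges at \<open>x\<close> and thus be closed
  twins.\<close>

lemma twin_leaves:
  assumes "{x, y} \<in> E" "{x, z} \<in> E" "degree E y = 1" "degree E z = 1"
  shows "y = z"
proof (rule ccontr)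
  assume n: "y \<noteq> z"
  have "d \<inter> {x, y} \<noteq> {} \<longleftrightarrow> d \<inter> {x, z} \<noteq> {}" if "d \<in> E" for d
    using leaf_edge[OF assms(3,1) that] leaf_edge[OF assms(4,2) that] by auto
  then have "closed_edge_nbhd E {x, y} = closed_edge_nbhd E {x, z}"
    unfolding closed_edge_nbhd_eq[OF assms(1)] closed_edge_nbhd_eq[OF assms(2)] by blast
  then have "edge_twins E {x, y} {x, z}"
    using assms n by (auto simp: edge_twins_def doubleton_eq_iff)
  then show False using twin_free by (auto simp: edge_twin_free_def)
qed

text \<open>The edges \<open>{x, z}\<close> and \<open>{y, z}\<close> would both meet the triangle
  and the edges at \<open>z\<close>, and nothing else.\<close>

lemma twin_triangle:
  assumes e: "{x, y} \<in> E" "{x, z} \<in> E" "{y, z} \<in> E" and d: "degree E x = 2" "degree E y = 2"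
  shows False
proof -
  have n: "x \<noteq> y" "x \<noteq> z" "y \<noteq> z" using e edge_neq by blast+
  have x: "d = {x, y} \<or> d = {x, z}" if "d \<in> E" "x \<in> d" for d
    using degree_2_cases[OF finite_E d(1) e(1,2) _ _ _ that] n by (auto simp: doubleton_eq_iff)
  have y: "d = {x, y} \<or> d = {y, z}" if "d \<in> E" "y \<in> d" for d
    using degree_2_cases[OF finite_E d(2) e(1,3) _ _ _ that] n by (auto simp: doubleton_eq_iff)
  have "d \<inter> {x, z} \<noteq> {} \<longleftrightarrow> d \<inter> {y, z} \<noteq> {}" if "d \<in> E" for d
    using x[OF that] y[OF that] by auto
  then have "closed_edge_nbhd E {x, z} = closed_edge_nbhd E {y, z}"
    unfolding closed_edge_nbhd_eq[OF e(2)] closed_edge_nbhd_eq[OF e(3)] by blast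
  then have "edge_twins E {x, z} {y, z}"
    using e n by (auto simp: edge_twins_def doubleton_eq_iff)
  then show False using twin_free by (auto simp: edge_twin_free_def)
qed

text \<open>The component would be a path with three edges, whose end edges are open twins with
  common neighbourhood \<open>{{x, y}}\<close>.\<close>

lemma twin_path:
  assumes e: "{x, y} \<in> E" "{x, l} \<in> E" "{y, m} \<in> E"
    and d: "degree E x = 2" "degree E y = 2" "degree E l = 1" "degree E m = 1"
  shows False
proof -
  have n: "x \<noteq> y" "x \<noteq> l" "y \<noteq> m" using e edge_neq by blast+
  have n': "l \<noteq> y" "m \<noteq> x" using d by auto
  have x: "f = {x, y} \<or> f = {x, l}" if "f \<in> E" "x \<in> f" for f
    using degree_2_cases[OF finite_E d(1) e(1,2) _ _ _ that] n n' by (auto simp: doubleton_eq_iff)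
  have y: "f = {x, y} \<or> f = {y, m}" if "f \<in> E" "y \<in> f" for f
    using degree_2_cases[OF finite_E d(2) e(1,3) _ _ _ that] n n' by (auto simp: doubleton_eq_iff)
  have l: "f = {x, l}" if "f \<in> E" "l \<in> f" for f using leaf_edge[OF d(3) e(2) that] .
  have m: "f = {y, m}" if "f \<in> E" "m \<in> f" for f using leaf_edge[OF d(4) e(3) that] .
  have neq: "{x, y} \<noteq> {x, l}" "{x, y} \<noteq> {y, m}" "{x, l} \<noteq> {y, m}"
    using n n' by (auto simp: doubleton_eq_iff)
  have "edge_nbhd E {x, l} = {{x, y}}"
    unfolding edge_nbhd_def using x l e neq by blast
  moreover have "edge_nbhd E {y, m} = {{x, y}}"
    unfolding edge_nbhd_def using y m e neq by blast
  ultimately have "edge_twins E {x, l} {y, m}"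
    using e neq by (simp add: edge_twins_def)
  then show False using twin_free by (auto simp: edge_twin_free_def)
qed

end

section \<open>Graphs with a leaf: pendant edges as singletons\<close>

locale leafy_colouring = twin_free_graph +
  fixes c :: "'a set \<Rightarrow> bool" and h :: "'a set \<Rightarrow> 'a set"
  assumes h: "h = (\<lambda>e. e - {v. degree E v = 1})"
    and col: "stack_colouring (h ` E) c []"
begin

sublocale stack_colouring "h ` E" c "[]" by (rule col)

definition "D k = {e \<in> E. c (h e) = k}"

lemma h_core: "{x, y} \<in> E \<Longrightarrow> 2 \<le> degree E x \<Longrightarrow> 2 \<le> degree E y \<Longrightarrow> h {x, y} = {x, y}"
  by (auto simp: h)

lemma h_support: "{x, y} \<in> E \<Longrightarrow> degree E y = 1 \<Longrightarrow> h {x, y} = {x}"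
  using support_degree[of x y] by (auto simp: h)

text \<open>Two leaves at one vertex would give twins, and an edge between two leaves would be
  isolated; so deleting the leaves from the edges merges no edges and empties none. This is what
  preserves the degrees of the other vertices.\<close>

lemma inj_h: "inj_on h E"
proof (rule inj_onI)
  fix e f assume ef: "e \<in> E" "f \<in> E" "h e = h f"
  obtain x y where e: "e = {x, y}" "2 \<le> degree E x"
  proof -
    obtain x y where xy: "e = {x, y}" using ef edge_obtain by metis
    then have "2 \<le> degree E x \<or> 2 \<le> degree E y"
      using not_both_leaves[of x y] degree_ge1[of x y] degree_ge1[of y x] ef by (force simp: insert_commute)
    then show ?thesis using that xy by (metis insert_commute)
  qed
  show "e = f"
  proof (cases "degree E y = 1")
    case True
    then have "h f = {x}" using h_support ef e by simp
    then have "x \<in> f" by (auto simp: h)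
    moreover have "card f = 2" using ef card_edge by blast
    ultimately obtain z where z: "f = {x, z}" "x \<noteq> z" by (auto simp: card_2_iff)
    then have "degree E z = 1" using \<open>h f = {x}\<close> by (auto simp: h)
    then show ?thesis using twin_leaves[of x y z] True ef e z by simp
  next
    case False
    then have "2 \<le> degree E y" using degree_ge1[of y x] ef e by (simp add: insert_commute)
    then have "e \<subseteq> f" using h_core ef e by (auto simp: h)
    moreover have "card e = 2" "card f = 2" using ef card_edge by auto
    ultimately show ?thesis using card_subset_eq[of f e] by (metis card.infinite zero_neq_numeral)
  qed
qed

lemma degree_h: "2 \<le> degree E x \<Longrightarrow> degree (h ` E) x = degree E x"
proof -
  assume x: "2 \<le> degree E x"
  have "{d \<in> h ` E. x \<in> d} = h ` {e \<in> E. x \<in> e}" using x by (auto simp: h)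
  moreover have "inj_on h {e \<in> E. x \<in> e}" using inj_h by (auto intro: inj_on_subset)
  ultimately show ?thesis by (simp add: degree_def card_image)
qed

lemma uncovered_leaf:
  assumes "{x, y} \<in> E" "uncovered (D k) y" shows "degree E y = 1"
proof (rule ccontr)
  assume "degree E y \<noteq> 1"
  then have "2 \<le> degree E y" using degree_ge1[of y x] assms(1) by (simp add: insert_commute)
  then obtain d where "d \<in> h ` E" "y \<in> d" "c d = k" using both_colours[of y k] degree_h by auto
  then obtain e where "e \<in> E" "y \<in> h e" "c (h e) = k" by blast
  moreover have "y \<in> e" using calculation(2) by (simp add: h)
  ultimately show False using assms(2) by (auto simp: uncovered_def D_def)
qed

lemma lone_h:
  assumes l: "lone (D k) x y" and "2 \<le> degree E x" "2 \<le> degree E y"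
  shows "lone (colour_class (h ` E) c k) x y"
proof -
  have xy: "x \<noteq> y" "{x, y} \<in> E" "c (h {x, y}) = k" using l by (auto simp: lone_def D_def)
  have hxy: "h {x, y} = {x, y}" using h_core xy(2) assms(2,3) by blast
  then have "{x, y} \<in> h ` E" using xy(2) by force
  then have "{x, y} \<in> colour_class (h ` E) c k" using xy hxy by simp
  moreover have "d = {x, y}" if d: "d \<in> colour_class (h ` E) c k" "x \<in> d \<or> y \<in> d" for d
  proof -
    obtain e where e: "e \<in> E" "d = h e" "c (h e) = k" using d(1) by auto
    then have "x \<in> e \<or> y \<in> e" using d(2) by (auto simp: h)
    then have "e = {x, y}" using lone_eq[OF l, of e] e by (simp add: D_def)
    then show ?thesis using e hxy by simp
  qed
  ultimately show ?thesis using xy(1) unfolding lone_def by blast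
qed

lemma core_in: "{x, y} \<in> E \<Longrightarrow> 2 \<le> degree E x \<Longrightarrow> 2 \<le> degree E y \<Longrightarrow> {x, y} \<in> h ` E"
  using h_core[of x y] by force

lemma half_in: "bare E (D k) x \<Longrightarrow> {x} \<in> h ` E \<and> 2 \<le> degree E x"
  using uncovered_leaf h_support support_degree unfolding bare_def by (metis imageI)

text \<open>Here the degree-2 exceptions of the invariant meet twin-freeness:
  \<open>twin_triangle\<close> excludes the one for triangles, \<open>twin_path\<close> the one for
  two pendant edges, and the one for 4-cycles is passed on as \<open>lone_square\<close>.\<close>

lemma nearly_locating_class: "nearly_locating E (D k)"
proof
  show "D k \<subseteq> E" by (auto simp: D_def)
  show "\<not> uncovered (D k) y" if "{x, y} \<in> E" "uncovered (D k) x" for x y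
    using uncovered_leaf[of x y k] uncovered_leaf[of y x k] not_both_leaves[OF that(1)] that
    by (auto simp: insert_commute)
  show "y = z" if "{x, y} \<in> E" "{x, z} \<in> E" "uncovered (D k) y" "uncovered (D k) z" for x y z
    using twin_leaves[OF that(1,2)] uncovered_leaf that by blast
  show "{y, z} \<notin> E" if l: "lone (D k) x y" and xz: "{x, z} \<in> E" for x y z
  proof
    assume yz: "{y, z} \<in> E"
    have xy: "{x, y} \<in> E" using l by (auto simp: lone_def D_def)
    have n: "x \<noteq> y" "x \<noteq> z" "y \<noteq> z" using xy xz yz edge_neq by blast+
    have d: "2 \<le> degree E x" "2 \<le> degree E y" "2 \<le> degree E z"
      using two_edges_degree[of x y z] two_edges_degree[of y x z] two_edges_degree[of z x y] n xy xz yz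
      by (simp_all add: insert_commute)
    have "degree (h ` E) x = 2 \<and> degree (h ` E) y = 2"
      using triangle[OF lone_h[OF l d(1,2)], of z] core_in xz yz d n by auto
    then show False using twin_triangle[OF xy xz yz] degree_h d by simp
  qed
  show "degree E x = 2 \<and> degree E y = 2 \<or> degree E z = 2 \<and> degree E w = 2"
    if l: "lone (D k) x y" "lone (D k) z w" "{x, y} \<inter> {z, w} = {}" and e: "{x, z} \<in> E" "{y, w} \<in> E"
    for x y z w
  proof -
    have xy: "{x, y} \<in> E" "{z, w} \<in> E" using l by (auto simp: lone_def D_def)
    have d: "2 \<le> degree E x" "2 \<le> degree E y" "2 \<le> degree E z" "2 \<le> degree E w"
      using two_edges_degree[of x y z] two_edges_degree[of y x w] two_edges_degree[of z w x]
        two_edges_degree[of w z y] l(3) xy e by (auto simp: insert_commute)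
    show ?thesis
      using square[OF lone_h[OF l(1) d(1,2)] lone_h[OF l(2) d(3,4)] l(3)] core_in e d degree_h by auto
  qed
  show "\<not> bare E (D k) y" if l: "lone (D k) x y" and x: "bare E (D k) x" for x y
  proof
    assume y: "bare E (D k) y"
    have xy: "{x, y} \<in> E" using l by (auto simp: lone_def D_def)
    note hx = half_in[OF x] and hy = half_in[OF y]
    have "degree (h ` E) x = 2 \<and> degree (h ` E) y = 2"
      using half_edges[OF lone_h[OF l]] hx hy by blast
    then have d: "degree E x = 2" "degree E y = 2" using hx hy degree_h by auto
    obtain l m where "{x, l} \<in> E" "uncovered (D k) l" "{y, m} \<in> E" "uncovered (D k) m"
      using x y unfolding bare_def by blast
    then show False using twin_path[OF xy _ _ d] uncovered_leaf by blast
  qed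
  show "\<not> (bare E (D k) x \<and> bare E (D k) y \<and> bare E (D k) z)"
    if xy: "{x, y} \<in> D k" "{y, z} \<in> D k" and xz: "x \<noteq> z" "{x, z} \<in> E" "{x, z} \<notin> D k"
      and cl: "\<And>d. d \<in> D k \<Longrightarrow> d \<inter> {x, y, z} \<noteq> {} \<Longrightarrow> d = {x, y} \<or> d = {y, z}" for x y z
  proof
    assume b: "bare E (D k) x \<and> bare E (D k) y \<and> bare E (D k) z"
    then have d: "2 \<le> degree E x" "2 \<le> degree E y" "2 \<le> degree E z"
      and hh: "{x} \<in> h ` E" "{y} \<in> h ` E" "{z} \<in> h ` E" using half_in by blast+
    have e: "{x, y} \<in> E" "{y, z} \<in> E" "c (h {x, y}) = k" "c (h {y, z}) = k" "c (h {x, z}) \<noteq> k"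
      using xy xz by (auto simp: D_def)
    have hc: "h {x, y} = {x, y}" "h {y, z} = {y, z}" "h {x, z} = {x, z}"
      using h_core e xz d by auto
    have "\<not> ({x} \<in> h ` E \<and> {y} \<in> h ` E \<and> {z} \<in> h ` E)"
    proof (rule cherry)
      show "{x, y} \<in> colour_class (h ` E) c k" "{y, z} \<in> colour_class (h ` E) c k"
        using core_in e d hc by auto
      show "{x, z} \<in> h ` E" using core_in xz d by blast
      show "c {x, z} \<noteq> k" using e(5) hc(3) by simp
      show "x \<noteq> y" "y \<noteq> z" "x \<noteq> z" using e edge_neq xz by blast+
      show "f = {x, y} \<or> f = {y, z}"
        if f: "f \<in> colour_class (h ` E) c k" "f \<inter> {x, y, z} \<noteq> {}" for f
      proof -
        obtain e' where e': "e' \<in> E" "f = h e'" "c (h e') = k" using f(1) by auto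
        then have "e' \<inter> {x, y, z} \<noteq> {}" using f(2) by (auto simp: h)
        then have "e' = {x, y} \<or> e' = {y, z}" using cl[of e'] e' by (simp add: D_def)
        then show ?thesis using e'(2) hc by auto
      qed
    qed
    then show False using hh by blast
  qed
qed

lemma classes_card: "card (D True) + card (D False) = card E"
proof -
  have "E = D True \<union> D False" by (auto simp: D_def)
  moreover have "card (D True \<union> D False) = card (D True) + card (D False)"
    by (rule card_Un_disjoint) (use finite_E in \<open>auto simp: D_def\<close>)
  ultimately show ?thesis by simp
qed

end

section \<open>Graphs without leaves: removing the half-edge\<close>

locale leafless_colouring = twin_free_graph +
  fixes c :: "'a set \<Rightarrow> bool" and s :: 'a
  assumes min_degree: "v \<in> \<Union>E \<Longrightarrow> 2 \<le> degree E v"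
    and s_in: "s \<in> \<Union>E"
    and col: "stack_colouring (insert {s} E) c []"
begin

sublocale stack_colouring "insert {s} E" c "[]" by (rule col)

definition "D k = {e \<in> E. c e = k}"

abbreviation "Ds \<equiv> D (c {s})"
abbreviation "Dt \<equiv> D (\<not> c {s})"

lemma half_notin: "{s} \<notin> E" using card_edge by force

lemma degree_insert: "degree (insert {s} E) x = (if x = s then Suc (degree E x) else degree E x)"
proof -
  have "{e \<in> insert {s} E. x \<in> e} = (if x = s then insert {s} {e \<in> E. x \<in> e} else {e \<in> E. x \<in> e})"
    by auto
  then show ?thesis using half_notin finite_E by (simp add: degree_def)
qed

text \<open>The half-edge raises the degree of \<open>s\<close> to at least 3, so \<open>s\<close>
  never belongs to an exceptional pair of degree 2.\<close>

lemma degree_2: 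
  assumes "x \<in> \<Union>E" "degree (insert {s} E) x = 2" shows "degree E x = 2"
  using min_degree[OF assms(1)] assms(2) by (auto simp: degree_insert split: if_splits)

lemma coloured_edge:
  assumes "x \<in> \<Union>E" shows "\<exists>e\<in>insert {s} E. x \<in> e \<and> c e = k"
proof (rule both_colours)
  show "2 \<le> degree (insert {s} E) x" using min_degree[OF assms] by (auto simp: degree_insert)
qed

lemma covered_t: "x \<in> \<Union>E \<Longrightarrow> \<exists>e\<in>Dt. x \<in> e"
  using coloured_edge[of x "\<not> c {s}"] unfolding D_def by blast

lemma covered_s: "x \<in> \<Union>E \<Longrightarrow> x \<noteq> s \<Longrightarrow> \<exists>e\<in>Ds. x \<in> e"
  using coloured_edge[of x "c {s}"] unfolding D_def by blast

lemma lone_class: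
  assumes l: "lone (D k) x y" and s: "k \<noteq> c {s} \<or> s \<notin> {x, y}"
  shows "lone (colour_class (insert {s} E) c k) x y"
proof -
  have "d = {x, y}" if "d \<in> colour_class (insert {s} E) c k" "x \<in> d \<or> y \<in> d" for d
  proof -
    have "d \<in> E" using that s by auto
    then show ?thesis using lone_eq[OF l, of d] that by (simp add: D_def)
  qed
  moreover have "{x, y} \<in> colour_class (insert {s} E) c k" "x \<noteq> y" 
    using l by (auto simp: lone_def D_def)
  ultimately show ?thesis unfolding lone_def by blast
qed

text \<open>With \<open>s\<close> as the only possible uncovered vertex, a \<open>bare\<close>
  vertex is a neighbour of \<open>s\<close>, and two \<open>bare\<close> ends of a one-edge
  component would form a triangle with \<open>s\<close>. The set may differ from a colour class as
  long as its one-edge components are components of one class, since \<open>triangle\<close> and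
  \<open>square\<close> speak only of these.\<close>

lemma nearly_locating_leafless:
  assumes sub: "D' \<subseteq> E"
    and cov: "\<And>y. y \<in> \<Union>E \<Longrightarrow> uncovered D' y \<Longrightarrow> y = s"
    and lone: "\<And>x y. lone D' x y \<Longrightarrow> lone (colour_class (insert {s} E) c k) x y"
    and cherry: "\<And>x y z. uncovered D' s \<Longrightarrow> {x, y} \<in> D' \<Longrightarrow> {y, z} \<in> D' \<Longrightarrow> x \<noteq> z \<Longrightarrow> {x, z} \<in> E \<Longrightarrow>
      {x, z} \<notin> D' \<Longrightarrow> {x, s} \<in> E \<Longrightarrow> {y, s} \<in> E \<Longrightarrow> {z, s} \<in> E \<Longrightarrow>
      (\<And>d. d \<in> D' \<Longrightarrow> d \<inter> {x, y, z} \<noteq> {} \<Longrightarrow> d = {x, y} \<or> d = {y, z}) \<Longrightarrow> False"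
  shows "nearly_locating E D'"
proof
  have cov': "y = s" if "{x, y} \<in> E" "uncovered D' y" for x y using cov[of y] that by blast
  have bare: "uncovered D' s \<and> {x, s} \<in> E" if "bare E D' x" for x
    using cov' that unfolding bare_def by blast
  show "D' \<subseteq> E" by (rule sub)
  show "\<not> uncovered D' y" if "{x, y} \<in> E" "uncovered D' x" for x y
    using cov'[of x y] cov'[of y x] edge_neq[OF that(1)] that by (auto simp: insert_commute)
  show "y = z" if "{x, y} \<in> E" "{x, z} \<in> E" "uncovered D' y" "uncovered D' z" for x y z
    using cov' that by blast
  have tri: "{y, z} \<notin> E" if l: "lone D' x y" and xz: "{x, z} \<in> E" for x y z
  proof
    assume yz: "{y, z} \<in> E"
    have xy: "{x, y} \<in> E" using l sub by (auto simp: lone_def)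
    have n: "z \<notin> {x, y}" using xz yz edge_neq by blast
    have "degree (insert {s} E) x = 2 \<and> degree (insert {s} E) y = 2"
      using triangle[OF lone[OF l] _ _ n] xz yz by blast
    moreover have "x \<in> \<Union>E" "y \<in> \<Union>E" using xy by auto
    ultimately show False using twin_triangle[OF xy xz yz] degree_2 by blast
  qed
  then show "{y, z} \<notin> E" if "lone D' x y" "{x, z} \<in> E" for x y z using that by blast
  show "degree E x = 2 \<and> degree E y = 2 \<or> degree E z = 2 \<and> degree E w = 2"
    if l: "lone D' x y" "lone D' z w" "{x, y} \<inter> {z, w} = {}" and e: "{x, z} \<in> E" "{y, w} \<in> E"
    for x y z w
  proof -
    have "x \<in> \<Union>E" "y \<in> \<Union>E" "z \<in> \<Union>E" "w \<in> \<Union>E" using e by auto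
    then show ?thesis
      using square[OF lone[OF l(1)] lone[OF l(2)] l(3)] e degree_2 by blast
  qed
  show "\<not> bare E D' y" if "lone D' x y" "bare E D' x" for x y
    using tri[OF that(1)] bare that(2) by blast
  show "\<not> (bare E D' x \<and> bare E D' y \<and> bare E D' z)"
    if xy: "{x, y} \<in> D'" "{y, z} \<in> D'" and xz: "x \<noteq> z" "{x, z} \<in> E" "{x, z} \<notin> D'"
      and cl: "\<And>d. d \<in> D' \<Longrightarrow> d \<inter> {x, y, z} \<noteq> {} \<Longrightarrow> d = {x, y} \<or> d = {y, z}" for x y z
    using cherry[OF _ xy xz _ _ _ cl] bare by blast
qed

lemma nearly_locating_t: "nearly_locating E Dt"
proof (rule nearly_locating_leafless)
  show "Dt \<subseteq> E" by (auto simp: D_def)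
  have cov: "\<not> uncovered Dt y" if "y \<in> \<Union>E" for y using covered_t[OF that] by (auto simp: uncovered_def)
  then show "y = s" if "y \<in> \<Union>E" "uncovered Dt y" for y using that by blast
  show "lone (colour_class (insert {s} E) c (\<not> c {s})) x y" if "lone Dt x y" for x y
    using lone_class[OF that] by simp
qed (use covered_t[OF s_in] in \<open>auto simp: uncovered_def\<close>)

lemma classes_card: "card Ds + card Dt = card E"
proof -
  have "E = Ds \<union> Dt" by (auto simp: D_def)
  moreover have "card (Ds \<union> Dt) = card Ds + card Dt"
    by (rule card_Un_disjoint) (use finite_E in \<open>auto simp: D_def\<close>)
  ultimately show ?thesis by simp
qed

text \<open>An edge at \<open>s\<close> lying on a short cycle of the second class can change its class: the components of
  the second class keep their vertex sets, and \<open>s\<close> becomes covered by the first class.\<close>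
lemma move_edge:
  assumes st: "{s, t} \<in> Dt"
    and a: "{s, a} \<in> Dt" "a \<noteq> t" "e \<in> Dt" "a \<in> e" "s \<notin> e"
    and b: "{t, b} \<in> Dt" "b \<noteq> s" "f \<in> Dt" "b \<in> f" "t \<notin> f"
  shows "nearly_locating E (insert {s, t} Ds)" "nearly_locating E (Dt - {{s, t}})"
    "card (insert {s, t} Ds) + card (Dt - {{s, t}}) = card E"
proof -
  have n: "s \<noteq> t" using st edge_neq by (auto simp: D_def)
  have stE: "{s, t} \<in> E" "{s, t} \<notin> Ds" using st by (auto simp: D_def)
  have tE: "t \<in> \<Union>E" using stE by auto
  have fin: "finite Ds" "finite Dt" using finite_E by (auto simp: D_def)
  show "card (insert {s, t} Ds) + card (Dt - {{s, t}}) = card E"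
    using classes_card stE(2) fin card_Suc_Diff1[OF fin(2) st] by simp
  let ?A = "insert {s, t} Ds"
  have covA: "\<not> uncovered ?A y" if "y \<in> \<Union>E" for y
    using covered_s[OF that] by (auto simp: uncovered_def)
  show "nearly_locating E ?A"
  proof (rule nearly_locating_leafless)
    show "?A \<subseteq> E" using stE by (auto simp: D_def)
    show "y = s" if "y \<in> \<Union>E" "uncovered ?A y" for y using covA that by blast
    show "lone (colour_class (insert {s} E) c (c {s})) x y" if l: "lone ?A x y" for x y
    proof -
      have xy: "x \<noteq> y" using l by (simp add: lone_def)
      obtain d where d: "d \<in> Ds" "t \<in> d" using covered_s[OF tE] n by blast
      have "t \<notin> {x, y}"
      proof
        assume "t \<in> {x, y}"
        then have "d = {x, y}" "{s, t} = {x, y}"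
          using lone_eq[OF l, of d] lone_eq[OF l, of "{s, t}"] d by auto
        then show False using d stE by simp
      qed
      moreover have sn: "s \<notin> {x, y}"
      proof
        assume "s \<in> {x, y}"
        then have "{s, t} = {x, y}" using lone_eq[OF l, of "{s, t}"] by auto
        then show False using calculation by blast
      qed
      moreover have "{x, y} \<in> ?A" "{x, y} \<noteq> {s, t}"
        using l calculation by (auto simp: lone_def)
      then have "{x, y} \<in> Ds" by blast
      moreover have "g = {x, y}" if "g \<in> Ds" "x \<in> g \<or> y \<in> g" for g
        using lone_eq[OF l, of g] that by blast
      ultimately have "lone Ds x y" using xy unfolding lone_def by blast
      then show ?thesis using lone_class sn by blast
    qed
  qed (use covA[OF s_in] in blast)
  let ?B = "Dt - {{s, t}}"
  have es: "e \<in> ?B" "f \<in> ?B" using a b by auto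
  have sa: "{s, a} \<in> ?B" "{t, b} \<in> ?B" using a b n by (auto simp: doubleton_eq_iff)
  have covB: "\<not> uncovered ?B y" if y: "y \<in> \<Union>E" for y
  proof (cases "y \<in> {s, t}")
    case True
    then show ?thesis using sa not_uncovered[of _ ?B] by blast
  next
    case False
    obtain d where "d \<in> Dt" "y \<in> d" using covered_t[OF y] by blast
    then show ?thesis using not_uncovered[of d ?B y] False by auto
  qed
  show "nearly_locating E ?B"
  proof (rule nearly_locating_leafless)
    show "?B \<subseteq> E" by (auto simp: D_def)
    show "y = s" if "y \<in> \<Union>E" "uncovered ?B y" for y using covB that by blast
    show "lone (colour_class (insert {s} E) c (\<not> c {s})) x y" if l: "lone ?B x y" for x y
    proof -
      have xy: "x \<noteq> y" "{x, y} \<in> ?B" using l by (auto simp: lone_def)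
      have "s \<notin> {x, y}"
      proof
        assume "s \<in> {x, y}"
        then have eq: "{s, a} = {x, y}" using lone_eq[OF l sa(1)] by auto
        then have "a \<in> {x, y}" by blast
        then have "e = {x, y}" using lone_eq[OF l es(1)] a(4) by auto
        then show False using eq a(5) by blast
      qed
      moreover have "t \<notin> {x, y}"
      proof
        assume "t \<in> {x, y}"
        then have eq: "{t, b} = {x, y}" using lone_eq[OF l sa(2)] by auto
        then have "b \<in> {x, y}" by blast
        then have "f = {x, y}" using lone_eq[OF l es(2)] b(4) by auto
        then show False using eq b(5) by blast
      qed
      ultimately have "g = {x, y}" if "g \<in> Dt" "x \<in> g \<or> y \<in> g" for g
        using lone_eq[OF l, of g] that by auto
      then have "lone Dt x y" using xy unfolding lone_def by blast
      then show ?thesis using lone_class by simp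
    qed
  qed (use covB[OF s_in] in blast)
qed

text \<open>Only the class of the half-edge can suffer from its removal, and only at
  \<open>s\<close>: it may leave \<open>s\<close> uncovered or turn an edge at \<open>s\<close> into
  a one-edge component. A cherry violating \<open>cherry_bare\<close> has all its vertices adjacent
  to \<open>s\<close>; its chord then closes a triangle or a 4-cycle through \<open>s\<close> in the
  second class, and \<open>move_edge\<close> applies.\<close>

lemma split_exists:
  "\<exists>A B. nearly_locating E A \<and> nearly_locating E B \<and> card A + card B = card E"
proof -
  have DsE: "Ds \<subseteq> E" by (auto simp: D_def)
  have Dt: "e \<in> Dt" if "e \<in> E" "e \<notin> Ds" for e using that by (auto simp: D_def)
  have move_triangle: ?thesis
    if "{s, x} \<in> Dt" "{s, z} \<in> Dt" "{x, z} \<in> Dt" for x z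
  proof -
    have n: "s \<noteq> x" "s \<noteq> z" "x \<noteq> z" using that edge_neq by (auto simp: D_def)
    show ?thesis
      using move_edge[OF that(1,2) _ that(3) _ _ that(3) _ that(2)] n that by blast
  qed
  consider "uncovered Ds s" | y where "lone Ds s y" | "\<not> uncovered Ds s" "\<And>y. \<not> lone Ds s y" by blast
  then show ?thesis
  proof cases
    case 1
    have s: "{x, s} \<notin> Ds" "{s, x} \<notin> Ds" for x using 1 by (auto simp: uncovered_def)
    show ?thesis
    proof (cases "\<exists>x z. x \<noteq> z \<and> {x, z} \<in> E \<and> {x, z} \<notin> Ds \<and> {x, s} \<in> E \<and> {z, s} \<in> E")
      case True
      then obtain x z where xz: "{x, z} \<in> E" "{x, z} \<notin> Ds" "{x, s} \<in> E" "{z, s} \<in> E" by blast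
      then have "{s, x} \<in> E" "{s, z} \<in> E" by (simp_all add: insert_commute)
      then show ?thesis using move_triangle[of x z] Dt xz(1,2) s(2) by blast
    next
      case False
      have "nearly_locating E Ds"
      proof (rule nearly_locating_leafless)
        show "y = s" if "y \<in> \<Union>E" "uncovered Ds y" for y
          using covered_s[of y] that by (auto simp: uncovered_def)
        show "lone (colour_class (insert {s} E) c (c {s})) x y" if "lone Ds x y" for x y
        proof -
          have "s \<notin> {x, y}" using that s by (auto simp: lone_def)
          then show ?thesis using lone_class[OF that] by blast
        qed
      qed (use DsE False in blast)+
      then show ?thesis using nearly_locating_t classes_card by blast
    qed
  next
    case (2 y)
    have sy: "{s, y} \<in> Ds" "s \<noteq> y" "{s, y} \<in> E" using 2 DsE by (auto simp: lone_def)
    have only: "d = {s, y}" if "d \<in> Ds" "s \<in> d \<or> y \<in> d" for d using lone_eq[OF 2 that] .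
    have "y \<in> \<Union>E" using sy by blast
    then obtain d where d: "d \<in> Dt" "y \<in> d" using covered_t by blast
    then have "card d = 2" "d \<in> E" using card_edge by (auto simp: D_def)
    then obtain z where z: "d = {y, z}" "y \<noteq> z" using d by (auto simp: card_2_iff)
    have yz: "{y, z} \<in> Dt" "{y, z} \<notin> Ds" "{y, z} \<in> E" using d z by (auto simp: D_def)
    have zs: "z \<noteq> s" using yz sy by (auto simp: insert_commute)
    have zE: "z \<in> \<Union>E" using yz by blast
    \<comment> \<open>The one-edge component \<open>{s, y}\<close> is traded for an edge of the
      other class, at the price of uncovering \<open>s\<close>. The new edge is not a one-edge
      component, as \<open>z\<close> lies on another edge of \<open>Ds\<close>. The overlap with
      \<open>Dt\<close> does no harm because only cardinalities are added.\<close>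
    define A where "A = insert {y, z} (Ds - {{s, y}})"
    have yzA: "{y, z} \<in> A" by (simp add: A_def)
    have A_y: "g = {y, z}" if "g \<in> A" "y \<in> g" for g using that only[of g] by (auto simp: A_def)
    have A_s: "s \<notin> g" if "g \<in> A" for g using that only[of g] zs sy(2) by (auto simp: A_def)
    have A_Ds: "g \<in> A" if "g \<in> Ds" "s \<notin> g \<or> y \<notin> g" for g using that by (auto simp: A_def)
    have Ds_A: "g \<in> Ds" if "g \<in> A" "g \<noteq> {y, z}" for g using that by (auto simp: A_def)
    have AE: "A \<subseteq> E" using yz DsE by (auto simp: A_def)
    have finA: "finite Ds" using finite_E DsE finite_subset by blast
    have cA: "card A = card Ds"
      using yz card_Suc_Diff1[OF finA sy(1)] finA by (simp add: A_def)
    show ?thesis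
    proof (cases "\<exists>u v w. {u, v} \<in> A \<and> {v, w} \<in> A \<and> u \<noteq> w \<and> {u, w} \<in> E \<and> {u, w} \<notin> A \<and>
        {u, s} \<in> E \<and> {v, s} \<in> E \<and> {w, s} \<in> E")
      case False
      have "nearly_locating E A"
      proof (rule nearly_locating_leafless)
        show "x = s" if x: "x \<in> \<Union>E" "uncovered A x" for x
        proof (rule ccontr)
          assume xs: "x \<noteq> s"
          then obtain g where g: "g \<in> Ds" "x \<in> g" using covered_s x by blast
          then have "g \<notin> A" using x by (auto simp: uncovered_def)
          then have "g = {s, y}" using g by (auto simp: A_def)
          then have "x = y" using g xs by blast
          then show False using x yzA by (auto simp: uncovered_def)
        qed
        show "lone (colour_class (insert {s} E) c (c {s})) u v" if l: "lone A u v" for u v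
        proof -
          have uv: "u \<noteq> v" "{u, v} \<in> A" using l by (auto simp: lone_def)
          obtain g where g: "g \<in> Ds" "z \<in> g" using covered_s[OF zE zs] by blast
          then have "y \<notin> g" using only[of g] zs z(2) by auto
          then have gA: "g \<in> A" using A_Ds g by blast
          have ne: "{u, v} \<noteq> {y, z}"
          proof
            assume eq: "{u, v} = {y, z}"
            then have "z \<in> {u, v}" by blast
            then have "g = {u, v}" using lone_eq[OF l gA] g by auto
            then show False using eq \<open>y \<notin> g\<close> by auto
          qed
          have y: "y \<notin> {u, v}"
            using A_y[OF uv(2)] ne by blast
          have s: "s \<notin> {u, v}" using A_s[OF uv(2)] .
          have "g = {u, v}" if "g \<in> Ds" "u \<in> g \<or> v \<in> g" for g
          proof -
            have "g \<in> A" using A_Ds[OF that(1)] only[OF that(1)] that(2) y s by blast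
            then show ?thesis using lone_eq[OF l] that(2) by blast
          qed
          then have "lone Ds u v" using uv Ds_A ne unfolding lone_def by blast
          then show ?thesis using lone_class s by blast
        qed
        show "A \<subseteq> E" by (rule AE)
        show False if "{x, y} \<in> A" "{y, z} \<in> A" "x \<noteq> z" "{x, z} \<in> E" "{x, z} \<notin> A"
          "{x, s} \<in> E" "{y, s} \<in> E" "{z, s} \<in> E" for x y z
          using False that by blast
      qed
      then show ?thesis using nearly_locating_t classes_card cA by metis
    next
      case True
      then obtain u v w where t: "{u, v} \<in> A" "{v, w} \<in> A" "u \<noteq> w" "{u, w} \<in> E" "{u, w} \<notin> A"
        "{u, s} \<in> E" "{v, s} \<in> E" "{w, s} \<in> E" by blast
      have us: "s \<notin> {u, v}" "s \<notin> {v, w}" using A_s t by auto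
      \<comment> \<open>Exchanging the ends of the cherry makes \<open>w\<close> different from
        \<open>y\<close>, so that \<open>{s, w}\<close> lies in \<open>Dt\<close>.\<close>
      have "\<exists>u w. {u, v} \<in> A \<and> {v, w} \<in> A \<and> u \<noteq> w \<and> {u, w} \<in> E \<and> {u, w} \<notin> A \<and>
        {u, s} \<in> E \<and> {w, s} \<in> E \<and> w \<noteq> y"
      proof (cases "w = y")
        case True
        then show ?thesis using t by (intro exI[of _ w] exI[of _ u]) (auto simp: insert_commute)
      next
        case False
        then show ?thesis using t by blast
      qed
      then obtain u w where t: "{u, v} \<in> A" "{v, w} \<in> A" "u \<noteq> w" "{u, w} \<in> E" "{u, w} \<notin> A"
        "{u, s} \<in> E" "{w, s} \<in> E" "{v, s} \<in> E" "w \<noteq> y" using t(7) by blast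
      have us: "s \<noteq> u" "s \<noteq> v" "s \<noteq> w" using A_s t by auto
      have uw: "{u, w} \<in> Dt"
        using Dt[OF t(4)] A_Ds[of "{u, w}"] t(5) us by auto
      have sw: "{s, w} \<in> Dt"
        using Dt[of "{s, w}"] t(7,9) only[of "{s, w}"] us by (auto simp: insert_commute doubleton_eq_iff)
      show ?thesis
      proof (cases "u = y")
        case False
        then have "{s, u} \<in> Dt"
          using Dt[of "{s, u}"] t(6) only[of "{s, u}"] us by (auto simp: insert_commute doubleton_eq_iff)
        then show ?thesis using move_triangle sw uw by blast
      next
        case True
        then have "{u, v} = {y, z}" using A_y[OF t(1)] by blast
        then have v: "v = z" using True z(2) by (auto simp: doubleton_eq_iff)
        have sz: "{s, z} \<in> Dt"
          using Dt[of "{s, z}"] t(8) only[of "{s, z}"] v zs z(2) by (auto simp: insert_commute doubleton_eq_iff)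
        have zw: "z \<noteq> w" using t(2) v AE edge_neq by blast
        have zy: "{z, y} \<in> Dt" using yz(1) by (simp add: insert_commute)
        have "s \<notin> {u, w}" "z \<notin> {u, w}" using us True z(2) zw by auto
        then show ?thesis
          using move_edge[OF sz sw _ uw _ _ zy _ uw] zw sy(2) True by auto
      qed
    qed
  next
    case 3
    have "nearly_locating E Ds"
    proof (rule nearly_locating_leafless)
      show "y = s" if "y \<in> \<Union>E" "uncovered Ds y" for y
        using covered_s[of y] that by (auto simp: uncovered_def)
      show "lone (colour_class (insert {s} E) c (c {s})) x y" if l: "lone Ds x y" for x y
      proof -
        have "s \<notin> {x, y}" using 3(2) l lone_sym[OF l] by auto
        then show ?thesis using lone_class[OF l] by blast
      qed
    qed (use DsE 3(1) in blast)+
    then show ?thesis using nearly_locating_t classes_card by blast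
  qed
qed

end

section \<open>Connected graphs and the union of components\<close>

definition connected_edges :: "'a set set \<Rightarrow> bool" where
  "connected_edges E \<longleftrightarrow> (\<forall>S. S \<inter> \<Union>E \<noteq> {} \<longrightarrow> (\<forall>e\<in>E. e \<inter> S \<noteq> {} \<longrightarrow> e \<subseteq> S) \<longrightarrow> \<Union>E \<subseteq> S)"

context twin_free_graph
begin

lemma leafy_split:
  assumes conn: "connected_edges E" and sl: "{s, l} \<in> E" and l: "degree E l = 1"
  shows "\<exists>A B. nearly_locating E A \<and> nearly_locating E B \<and> card A + card B = card E"
proof -
  define L where "L = {v. degree E v = 1}"
  define h where "h = (\<lambda>e. e - L)"
  have s: "s \<notin> L" using not_both_leaves[OF sl] l by (auto simp: L_def)
  have h_cases: "h {x, y} = {x, y} \<and> x \<notin> L \<and> y \<notin> L \<or> h {x, y} = {x} \<and> x \<notin> L \<and> y \<in> L \<or>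
    h {x, y} = {y} \<and> x \<in> L \<and> y \<notin> L" if "{x, y} \<in> E" for x y
    using not_both_leaves[OF that] by (auto simp: h_def L_def)
  have "\<exists>c. stack_colouring (h ` E) c []"
  proof (rule colouring_exists)
    show "finite (h ` E)" using finite_E by simp
    show "card d = 1 \<or> card d = 2" if d: "d \<in> h ` E" for d
    proof -
      obtain e where e: "e \<in> E" "d = h e" using d by blast
      obtain x y where xy: "e = {x, y}" "x \<noteq> y" using edge_obtain[OF e(1)] .
      then have "d = {x, y} \<or> d = {x} \<or> d = {y}" using h_cases[of x y] e by metis
      then show ?thesis using xy(2) by (elim disjE) simp_all
    qed
    have "h {s, l} = {s}" using s l by (auto simp: h_def L_def)
    then show "{s} \<in> h ` E" using sl by force
    show "\<Union>(h ` E) \<subseteq> S" if sS: "s \<in> S" and cl: "\<And>u v. u \<in> S \<Longrightarrow> {u, v} \<in> h ` E \<Longrightarrow> v \<in> S" for S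
    proof -
      \<comment> \<open>A set closed under the shortened edges says nothing about leaves; replacing
        its leaves by those attached to it gives a set closed under \<open>E\<close>, to which
        connectedness applies.\<close>
      define T where "T = (S - L) \<union> {m \<in> L. \<exists>x\<in>S - L. {x, m} \<in> E}"
      have step: "y \<in> T" if xy: "{x, y} \<in> E" and x: "x \<in> T" for x y
      proof (cases "x \<in> L")
        case True
        then obtain w where w: "w \<in> S - L" "{w, x} \<in> E" using x by (auto simp: T_def)
        then have "{x, y} = {w, x}" using leaf_edge[of x w "{x, y}"] True xy by (simp add: L_def)
        then show ?thesis using w edge_neq[OF xy] by (auto simp: T_def doubleton_eq_iff)
      next
        case False
        then have xS: "x \<in> S - L" using x by (auto simp: T_def)
        show ?thesis
        proof (cases "y \<in> L")
          case True
          then show ?thesis using xS xy by (auto simp: T_def)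
        next
          case y: False
          then have "h {x, y} = {x, y}" using False by (auto simp: h_def)
          then have "{x, y} \<in> h ` E" using xy by force
          then show ?thesis using cl[of x y] xS y by (auto simp: T_def)
        qed
      qed
      have "e \<subseteq> T" if e: "e \<in> E" "e \<inter> T \<noteq> {}" for e
      proof -
        obtain x y where xy: "e = {x, y}" "x \<noteq> y" using edge_obtain[OF e(1)] .
        have "{x, y} \<in> E" "{y, x} \<in> E" using e xy by (simp_all add: insert_commute)
        then show ?thesis using step[of x y] step[of y x] e(2) xy by auto
      qed
      moreover have "s \<in> T \<inter> \<Union>E" using s sS sl by (auto simp: T_def)
      ultimately have "\<Union>E \<subseteq> T" using conn unfolding connected_edges_def by blast
      then show ?thesis by (auto simp: h_def T_def)
    qed
  qed
  then obtain c where c: "stack_colouring (h ` E) c []" by blast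
  interpret leafy_colouring E c h
    using twin_free_graph_axioms c h_def[unfolded L_def]
    by (intro leafy_colouring.intro leafy_colouring_axioms.intro)
  show ?thesis using nearly_locating_class classes_card by blast
qed

lemma leafless_split:
  assumes conn: "connected_edges E" and s: "s \<in> \<Union>E" and d: "\<And>v. v \<in> \<Union>E \<Longrightarrow> degree E v \<noteq> 1"
  shows "\<exists>A B. nearly_locating E A \<and> nearly_locating E B \<and> card A + card B = card E"
proof -
  have "\<exists>c. stack_colouring (insert {s} E) c []"
  proof (rule colouring_exists)
    show "finite (insert {s} E)" using finite_E by simp
    show "card d = 1 \<or> card d = 2" if "d \<in> insert {s} E" for d
      using that card_edge by auto
    show "{s} \<in> insert {s} E" by simp
    show "\<Union>(insert {s} E) \<subseteq> S"
      if sS: "s \<in> S" and cl: "\<And>u v. u \<in> S \<Longrightarrow> {u, v} \<in> insert {s} E \<Longrightarrow> v \<in> S" for S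
    proof -
      have "e \<subseteq> S" if e: "e \<in> E" "e \<inter> S \<noteq> {}" for e
      proof -
        obtain x y where xy: "e = {x, y}" "x \<noteq> y" using edge_obtain[OF e(1)] .
        have "{x, y} \<in> insert {s} E" "{y, x} \<in> insert {s} E" using e xy by (simp_all add: insert_commute)
        then show ?thesis using cl[of x y] cl[of y x] e(2) xy by auto
      qed
      moreover have "S \<inter> \<Union>E \<noteq> {}" using s sS by blast
      ultimately have "\<Union>E \<subseteq> S" using conn unfolding connected_edges_def by blast
      then show ?thesis using sS by simp
    qed
  qed
  then obtain c where c: "stack_colouring (insert {s} E) c []" by blast
  have "2 \<le> degree E v" if v: "v \<in> \<Union>E" for v
  proof -
    obtain e where "e \<in> E" "v \<in> e" using v by blast
    then have "1 \<le> degree E v" using degree_pos[OF finite_E] by blast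
    then show ?thesis using d[OF v] by simp
  qed
  then interpret leafless_colouring E c s
    using twin_free_graph_axioms s c
    by (intro leafless_colouring.intro leafless_colouring_axioms.intro)
  show ?thesis by (rule split_exists)
qed

lemma connected_half:
  assumes "connected_edges E"
  shows "\<exists>D. edge_locating_dominating E D \<and> 2 * card D \<le> card E"
proof (cases "E = {}")
  case True
  then show ?thesis by (intro exI[of _ "{}"]) (simp add: edge_locating_dominating_def)
next
  case False
  have "\<exists>A B. nearly_locating E A \<and> nearly_locating E B \<and> card A + card B = card E"
  proof (cases "\<exists>l\<in>\<Union>E. degree E l = 1")
    case True
    then obtain l e where l: "degree E l = 1" "e \<in> E" "l \<in> e" by blast
    obtain x y where xy: "e = {x, y}" "x \<noteq> y" using edge_obtain[OF l(2)] .
    then have "\<exists>s. {s, l} \<in> E" using l by (auto simp: insert_commute)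
    then show ?thesis using leafy_split[OF assms _ l(1)] by blast
  next
    case none: False
    obtain e where e: "e \<in> E" using False by blast
    obtain x y where xy: "e = {x, y}" "x \<noteq> y" using edge_obtain[OF e] .
    then have "x \<in> \<Union>E" using e by blast
    then show ?thesis using leafless_split[OF assms] none by blast
  qed
  then obtain A B where AB: "nearly_locating E A" "nearly_locating E B" "card A + card B = card E"
    by blast
  obtain A' where A': "edge_locating_dominating E A'" "card A' \<le> card A"
    using locating_dominating_exists[OF AB(1)] by blast
  obtain B' where B': "edge_locating_dominating E B'" "card B' \<le> card B"
    using locating_dominating_exists[OF AB(2)] by blast
  show ?thesis
  proof (cases "card A \<le> card B")
    case True
    then have "2 * card A' \<le> card E" using A'(2) AB(3) by linarith
    then show ?thesis using A'(1) by blast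
  next
    case False
    then have "2 * card B' \<le> card E" using B'(2) AB(3) by linarith
    then show ?thesis using B'(1) by blast
  qed
qed

end

text \<open>Neighbourhoods and degrees are determined inside a union of components, so neither twins
  nor isolated edges can arise.\<close>

lemma twin_free_subgraph:
  assumes "twin_free_graph E" "F \<subseteq> E" and sep: "\<And>e f. e \<in> F \<Longrightarrow> f \<in> E \<Longrightarrow> f \<inter> e \<noteq> {} \<Longrightarrow> f \<in> F"
  shows "twin_free_graph F"
proof -
  interpret twin_free_graph E by (rule assms(1))
  have nb: "edge_nbhd F e = edge_nbhd E e" if "e \<in> F" for e
    using that sep[OF that] assms(2) by (auto simp: edge_nbhd_def)
  have deg: "degree F v = degree E v" if "e \<in> F" "v \<in> e" for e v
  proof -
    have "{d \<in> F. v \<in> d} = {d \<in> E. v \<in> d}" using sep[OF that(1)] that(2) assms(2) by auto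
    then show ?thesis by (simp add: degree_def)
  qed
  show ?thesis
  proof
    show "finite F" using assms(2) finite_E finite_subset by blast
    show "card e = 2" if "e \<in> F" for e using that assms(2) card_edge by blast
    have "\<not> edge_twins F e f" for e f
    proof
      assume t: "edge_twins F e f"
      then have "e \<in> F" "f \<in> F" by (auto simp: edge_twins_def)
      then have "edge_twins E e f"
        using t nb assms(2) by (auto simp: edge_twins_def closed_edge_nbhd_def)
      then show False using twin_free by (auto simp: edge_twin_free_def)
    qed
    then show "edge_twin_free F" by (simp add: edge_twin_free_def)
    have "\<not> isolated_edge F e" for e
      using no_isolated deg assms(2) unfolding isolated_edge_def by (metis subsetD)
    then show "\<nexists>e. isolated_edge F e" by blast
  qed
qed

text \<open>Edges from different parts meet disjoint sets of chosen edges, and these differ because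
  domination makes them nonempty.\<close>

lemma locating_dominating_Un:
  assumes "edge_locating_dominating E1 D1" "edge_locating_dominating E2 D2"
    and sep: "\<And>e f. e \<in> E1 \<Longrightarrow> f \<in> E2 \<Longrightarrow> e \<inter> f = {}" and ne: "{} \<notin> E1" "{} \<notin> E2"
  shows "edge_locating_dominating (E1 \<union> E2) (D1 \<union> D2)"
proof -
  have sub: "D1 \<subseteq> E1" "D2 \<subseteq> E2" using assms(1,2) by (auto simp: edge_locating_dominating_def)
  have dominated: "\<forall>e\<in>E1 - D1. \<exists>d\<in>D1. e \<inter> d \<noteq> {}" "\<forall>e\<in>E2 - D2. \<exists>d\<in>D2. e \<inter> d \<noteq> {}"
    using assms(1,2) by (simp_all add: edge_locating_dominating_def)
  have dis: "E1 \<inter> E2 = {}" using sep ne by (metis disjoint_iff inf.idem)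
  have n1: "edge_nbhd (E1 \<union> E2) e \<inter> (D1 \<union> D2) = edge_nbhd E1 e \<inter> D1" if "e \<in> E1" for e
    using that sub sep[OF that] dis by (auto simp: edge_nbhd_def)
  have n2: "edge_nbhd (E1 \<union> E2) e \<inter> (D1 \<union> D2) = edge_nbhd E2 e \<inter> D2" if "e \<in> E2" for e
    using that sub sep[OF _ that] dis by (auto simp: edge_nbhd_def)
  have dom1: "edge_nbhd E1 e \<inter> D1 \<noteq> {}" if e: "e \<in> E1 - D1" for e
  proof -
    obtain d where "d \<in> D1" "e \<inter> d \<noteq> {}" using dominated(1) e by blast
    then have "d \<in> edge_nbhd E1 e \<inter> D1" using e sub by (auto simp: edge_nbhd_def)
    then show ?thesis by blast
  qed
  have cross: "edge_nbhd E1 e \<inter> D1 \<noteq> edge_nbhd E2 f \<inter> D2" if "e \<in> E1 - D1" for e f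
    using dom1[OF that] sub dis by blast
  show ?thesis
    unfolding edge_locating_dominating_def
  proof (intro conjI ballI impI)
    show "D1 \<union> D2 \<subseteq> E1 \<union> E2" using sub by blast
    show "\<exists>d\<in>D1 \<union> D2. e \<inter> d \<noteq> {}" if e: "e \<in> E1 \<union> E2 - (D1 \<union> D2)" for e
    proof -
      consider "e \<in> E1 - D1" | "e \<in> E2 - D2" using e by blast
      then show ?thesis using dominated by cases (meson UnI1 UnI2)+
    qed
    fix e f assume ef: "e \<in> E1 \<union> E2 - (D1 \<union> D2)" "f \<in> E1 \<union> E2 - (D1 \<union> D2)" "e \<noteq> f"
    consider "e \<in> E1 - D1" "f \<in> E1 - D1" | "e \<in> E2 - D2" "f \<in> E2 - D2" |
      "e \<in> E1 - D1" "f \<in> E2 - D2" | "e \<in> E2 - D2" "f \<in> E1 - D1" using ef by blast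
    then show "edge_nbhd (E1 \<union> E2) e \<inter> (D1 \<union> D2) \<noteq> edge_nbhd (E1 \<union> E2) f \<inter> (D1 \<union> D2)"
    proof cases
      case 1
      then show ?thesis using assms(1) ef(3) n1 unfolding edge_locating_dominating_def by simp
    next
      case 2
      then show ?thesis using assms(2) ef(3) n2 unfolding edge_locating_dominating_def by simp
    next
      case 3
      then show ?thesis using cross[OF 3(1)] n1[of e] n2[of f] by simp
    next
      case 4
      then show ?thesis using cross[OF 4(2), of e] n1[of f] n2[of e] by simp
    qed
  qed
qed

lemma half_locating_dominating:
  assumes "twin_free_graph E"
  shows "\<exists>D. edge_locating_dominating E D \<and> 2 * card D \<le> card E"
  using assms
proof (induction "card E" arbitrary: E rule: less_induct)
  case less
  interpret twin_free_graph E by (rule less.prems)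
  show ?case
  proof (cases "connected_edges E")
    case True
    then show ?thesis by (rule connected_half)
  next
    case False
    then obtain S where S: "S \<inter> \<Union>E \<noteq> {}" "\<forall>e\<in>E. e \<inter> S \<noteq> {} \<longrightarrow> e \<subseteq> S" "\<not> \<Union>E \<subseteq> S"
      unfolding connected_edges_def by blast
    define E1 where "E1 = {e \<in> E. e \<inter> S \<noteq> {}}"
    define E2 where "E2 = {e \<in> E. e \<inter> S = {}}"
    have E: "E = E1 \<union> E2" "E1 \<inter> E2 = {}" by (auto simp: E1_def E2_def)
    have "E1 \<noteq> {}" using S(1) by (auto simp: E1_def)
    moreover obtain e where e: "e \<in> E" "\<not> e \<subseteq> S" using S(3) by blast
    then have "e \<in> E2" using S(2) by (auto simp: E2_def)
    then have "E2 \<noteq> {}" by blast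
    moreover have fin: "finite E1" "finite E2" using finite_E E(1) by auto
    moreover have card: "card E = card E1 + card E2" using card_Un_disjoint[OF fin E(2)] E(1) by simp
    ultimately have lt: "card E1 < card E" "card E2 < card E"
      by (simp_all add: card_gt_0_iff)
    have sep: "e \<inter> f = {}" if "e \<in> E1" "f \<in> E2" for e f
      using that S(2) by (auto simp: E1_def E2_def)
    have "twin_free_graph E1" "twin_free_graph E2"
      using twin_free_subgraph[OF less.prems, of E1] twin_free_subgraph[OF less.prems, of E2] sep E
      by (auto simp: Int_commute)
    then obtain D1 D2 where D: "edge_locating_dominating E1 D1" "2 * card D1 \<le> card E1"
      "edge_locating_dominating E2 D2" "2 * card D2 \<le> card E2"
      using less.hyps[OF lt(1)] less.hyps[OF lt(2)] by blast
    have "{} \<notin> E" using card_edge by force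
    then have "edge_locating_dominating E (D1 \<union> D2)"
      using locating_dominating_Un[OF D(1,3) sep] E(1) by auto
    moreover have "card (D1 \<union> D2) \<le> card D1 + card D2" by (rule card_Un_le)
    ultimately show ?thesis using D(2,4) card by (intro exI[of _ "D1 \<union> D2"]) auto
  qed
qed

theorem theorem2:
  fixes V :: "'a set" and E :: "'a set set" and m :: nat
  assumes "fin_simple_graph V E"
    and "edge_twin_free E"
    and "\<nexists>e. isolated_edge E e"
    and "card E = m"
  shows "real (edge_location_domination_number E) \<le> real m / 2"
proof -
  interpret fin_simple_graph V E by (rule assms(1))
  have "twin_free_graph E"
    by unfold_locales (use finite_edges edge_card assms(2,3) in auto)
  then obtain D where D: "edge_locating_dominating E D" "2 * card D \<le> card E"
    using half_locating_dominating by blast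
  have "edge_location_domination_number E \<le> card D"
    unfolding edge_location_domination_number_def
    using finite_edge_locating_dominating[OF finite_edges] D(1) by (intro Min_le) auto
  then show ?thesis using D(2) assms(4) by linarith
qed

end
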